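(* Let $T$ be a canonical theory, $\phi\in\mathrm{Hom}^+(\mathcal A[T],\mathbb R)$ and $\ell\in\mathbb N_+$. If $\phi$ satisfies $\mathrm{Independence}[\ell]$ then it satisfies $\mathrm{Independence}[\ell-1]$; if $\phi$ satisfies $\mathrm{UCouple}[\ell]$ then it satisfies $\mathrm{UCouple}[\ell-1]$; and if $\phi$ satisfies $\mathrm{UInduce}[\ell]$ then it satisfies $\mathrm{UInduce}[\ell-1]$.
   Context: All languages are finite relational first-order languages; each predicate symbol $P$ has an arity $k(P)\ge 1$. A canonical theory $T$ over a language $\mathcal L$ is a universal theory over $\mathcal L$ containing, for every $P\in\mathcal L$, the axiom $\forall\vec x\,(\bigvee_{1\le i<j\le k(P)}x_i=x_j\to\neg P(x_1,\dots,x_{k(P)}))$. For theories $T_1,T_2$, $T_1\cup T_2$ denotes their disjoint union (languages renamed to be disjoint). $\mathcal K_V[T]$ is the set of models of $T$ with vertex set $V$; $\mathcal M_n[T]$ the set of isomorphism classes of $n$-vertex models, $\mathcal M[T]=\bigcup_{n\ge1}\mathcal M_n[T]$. Limit objects: for finite models $M,N$ let $p(M,N)$ be the probability that a uniformly random $|M|$-subset of $V(N)$ induces a copy of $M$. $\mathrm{Hom}^+(\mathcal A[T],\mathbb R)$ is the set of functions $\phi:\mathcal M[T]\to[0,1]$ with $\phi(M)=\lim_n p(M,N_n)$ for some sequence of finite models $N_n$ of $T$ of strictly increasing size for which all these limits exist. For $K\in\mathcal K_V[T]$ with $|V|=m$, $\phi(\langle K\rangle):=\frac{|\mathrm{Aut}(K)|}{m!}\phi([K])$.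 Theons: for an atomless complete probability space $\Omega=(X,\mathcal A,\mu)$ and a set $V$, let $r(V)$ be the set of finite nonempty subsets of $V$, $r(V,\ell)$ those of size $\le\ell$, $\mathcal E_V(\Omega)=X^{r(V)}$, $\mathcal E_{V,\ell}(\Omega)=X^{r(V,\ell)}$ (product measure), $\mathcal E_k=\mathcal E_{[k]}$. For an injection $\alpha:U\to V$, $\alpha^*(x)_A=x_{\alpha(A)}$. A $T$-on over $\Omega$ is a family of measurable sets (peons) $\mathcal N_P\subseteq\mathcal E_{k(P)}(\Omega)$, $P\in\mathcal L$, such that for $\theta$ random in $\mathcal E_{\mathbb N_+}(\Omega)$ with law $\mu$, the random structure $\mathbf K$ on $\mathbb N_+$ with $R_P(\mathbf K)=\{\alpha:[k(P)]\to\mathbb N_+\text{ injective}:\alpha^*(\theta)\in\mathcal N_P\}$ (the exchangeable array of $\mathcal N$) is a.s. a model of $T$; then $\phi_{\mathcal N}(M):=\Pr[\mathbf K|_{[|M|]}\cong M]$, and every $\phi$ equals some $\phi_{\mathcal N}$. Rank and independence: a peon $\mathcal N_P\subseteq\mathcal E_k(\Omega)$ has rank $\le r$ if $\mathcal N_P=\mathcal H\times X^{\{A\subseteq[k]:|A|>r\}}$ for some measurable $\mathcal H\subseteq\mathcal E_{k,r}(\Omega)$; it is $\ell$-independent if $\mathcal N_P=\mathcal E_{k,\ell}(\Omega)\times\mathcal H$ for some $\mathcal H\subseteq X^{\{A\subseteq[k]:|A|>\ell\}}$. $\mathrm{rk}(\phi)$ is the minimum over $T$-ons $\mathcal N$ with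 $\phi_{\mathcal N}=\phi$ of the maximum rank of the peons of $\mathcal N$. $\phi$ satisfies $\mathrm{Independence}[\ell]$ if $\phi=\phi_{\mathcal N}$ for some $T$-on all of whose peons are $\ell$-independent. Interpretations and couplings: an open interpretation $I:T_1\rightsquigarrow T_2$ assigns to each predicate $P$ of $T_1$ a quantifier-free formula $I(P)(x_1,\dots,x_{k(P)})$ of the language of $T_2$ such that for every model $K$ of $T_2$ the structure $I(K)$ on $V(K)$ with $R_P(I(K))=\{\alpha: K\models I(P)(\alpha)\}$ is a model of $T_1$; $\phi^I(M):=\sum\{\phi(N):N\in\mathcal M_{|M|}[T_2],I(N)\cong M\}$. The structure-erasing interpretation $T_1\rightsquigarrow T_1\cup T_2$ sends $P$ to $P$. A coupling of $\phi_i\in\mathrm{Hom}^+(\mathcal A[T_i],\mathbb R)$ ($i=1,2$) is $\xi\in\mathrm{Hom}^+(\mathcal A[T_1\cup T_2],\mathbb R)$ with $\xi^{I_i}=\phi_i$ for the structure-erasing $I_i$. The independent coupling is $(\phi_1\otimes\phi_2)(\langle M\rangle)=\phi_1(\langle I_1(M)\rangle)\phi_2(\langle I_2(M)\rangle)$. $\phi_1,\phi_2$ are uniquely coupleable if $\phi_1\otimes\phi_2$ is their only coupling. $\phi$ satisfies $\mathrm{UCouple}[\ell]$ if it is uniquely coupleable with every $\psi\in\mathrm{Hom}^+(\mathcal A[T'],\mathbb R)$ with $\mathrm{rk}(\psi)\le\ell$, for every canonical theory $T'$. Unique inducibility: $T_{\ell\text{-Hypergraph}}$ has one $\ell$-ary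 predicate $E$ with the canonical axiom and the symmetry axioms $E(x_1,\dots,x_\ell)\to E(x_{\sigma(1)},\dots,x_{\sigma(\ell)})$, $\sigma\in S_\ell$. For $\ell\ge1$, $\phi\in\mathrm{Hom}^+(\mathcal A[T],\mathbb R)$ satisfies $\mathrm{UInduce}[\ell]$ if for every $\psi\in\mathrm{Hom}^+(\mathcal A[T_{\ell\text{-Hypergraph}}],\mathbb R)$, every coupling $\xi$ of $\phi$ and $\psi$, and every $M\in\mathcal M[T\cup T_{\ell\text{-Hypergraph}}]$ whose hypergraph part is a complete $\ell$-uniform hypergraph, $\xi(M)=(\phi\otimes\psi)(M)$. Every $\phi$ satisfies $\mathrm{UInduce}[0]$. *)

theory Defs
  imports "HOL-Probability.Probability" "HOL-Combinatorics.Permutations" "HOL-Library.Extended_Nat"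
begin

section \<open>Relational languages, universal theories and their models\<close>

text \<open>
  Natural numbers serve as variables of formulas and as vertices of the representatives of
  isomorphism classes. Indices start at 0: the set \<open>[n]\<close> is \<open>{..<n}\<close>, positive integers as
  vertices become \<open>UNIV :: nat set\<close>, and an \<open>n\<close>-tuple (a map out of \<open>[n]\<close>) is a list of length \<open>n\<close>.
\<close>

datatype 'p qf =
    Fls
  | Eq nat nat
  | Atom 'p "nat list"
  | Neg "'p qf"
  | Conj "'p qf" "'p qf"
  | Disj "'p qf" "'p qf"
  | Imp "'p qf" "'p qf"

text \<open>Only the universal closures of the formulas in \<open>axioms\<close> matter, so the theory is universal.\<close>

record 'p fo_theory =
  preds :: "'p set"
  arity :: "'p \<Rightarrow> nat"
  axioms :: "'p qf set"

fun qf_over :: "'p fo_theory \<Rightarrow> 'p qf \<Rightarrow> bool" where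
  "qf_over T Fls = True"
| "qf_over T (Eq i j) = True"
| "qf_over T (Atom P vs) = (P \<in> preds T \<and> length vs = arity T P)"
| "qf_over T (Neg F) = qf_over T F"
| "qf_over T (Conj F G) = (qf_over T F \<and> qf_over T G)"
| "qf_over T (Disj F G) = (qf_over T F \<and> qf_over T G)"
| "qf_over T (Imp F G) = (qf_over T F \<and> qf_over T G)"

fun qf_vars :: "'p qf \<Rightarrow> nat set" where
  "qf_vars Fls = {}"
| "qf_vars (Eq i j) = {i, j}"
| "qf_vars (Atom P vs) = set vs"
| "qf_vars (Neg F) = qf_vars F"
| "qf_vars (Conj F G) = qf_vars F \<union> qf_vars G"
| "qf_vars (Disj F G) = qf_vars F \<union> qf_vars G"
| "qf_vars (Imp F G) = qf_vars F \<union> qf_vars G"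

record ('p, 'v) struct =
  vertices :: "'v set"
  Rel :: "'p \<Rightarrow> 'v list set"

fun sat :: "('p, 'v) struct \<Rightarrow> (nat \<Rightarrow> 'v) \<Rightarrow> 'p qf \<Rightarrow> bool" where
  "sat K s Fls = False"
| "sat K s (Eq i j) = (s i = s j)"
| "sat K s (Atom P vs) = (map s vs \<in> Rel K P)"
| "sat K s (Neg F) = (\<not> sat K s F)"
| "sat K s (Conj F G) = (sat K s F \<and> sat K s G)"
| "sat K s (Disj F G) = (sat K s F \<or> sat K s G)"
| "sat K s (Imp F G) = (sat K s F \<longrightarrow> sat K s G)"

text \<open>Relations of symbols outside the language are required to be empty, so that two structures
  over the language are equal as soon as they agree on its symbols.\<close>

definition is_model :: "'p fo_theory \<Rightarrow> ('p, 'v) struct \<Rightarrow> bool" where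
  "is_model T K \<longleftrightarrow>
     (\<forall>P\<in>preds T. \<forall>xs\<in>Rel K P. length xs = arity T P \<and> set xs \<subseteq> vertices K) \<and>
     (\<forall>P. P \<notin> preds T \<longrightarrow> Rel K P = {}) \<and>
     (\<forall>F\<in>axioms T. \<forall>s. range s \<subseteq> vertices K \<longrightarrow> sat K s F)"

definition canonical_axiom :: "nat \<Rightarrow> 'p \<Rightarrow> 'p qf" where
  "canonical_axiom k P =
     Imp (foldr Disj [Eq i j. i \<leftarrow> [0..<k], j \<leftarrow> [Suc i..<k]] Fls) (Neg (Atom P [0..<k]))"

definition canonical_theory :: "'p fo_theory \<Rightarrow> bool" where
  "canonical_theory T \<longleftrightarrow>
     finite (preds T) \<and> (\<forall>P\<in>preds T. arity T P \<ge> 1) \<and>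
     (\<forall>F\<in>axioms T. qf_over T F) \<and>
     (\<forall>P\<in>preds T. canonical_axiom (arity T P) P \<in> axioms T)"

definition disjoint_union :: "'p fo_theory \<Rightarrow> 'q fo_theory \<Rightarrow> ('p + 'q) fo_theory" where
  "disjoint_union T1 T2 =
     \<lparr>preds = preds T1 <+> preds T2, arity = case_sum (arity T1) (arity T2),
      axioms = map_qf Inl ` axioms T1 \<union> map_qf Inr ` axioms T2\<rparr>"

definition hypergraph_theory :: "nat \<Rightarrow> unit fo_theory" where
  "hypergraph_theory l =
     \<lparr>preds = {()}, arity = (\<lambda>_. l),
      axioms = insert (canonical_axiom l ())
        {Imp (Atom () [0..<l]) (Atom () (map \<sigma> [0..<l])) |\<sigma>. \<sigma> permutes {..<l}}\<rparr>"

lemma qf_over_foldr_Disj: "qf_over T (foldr Disj Fs G) \<longleftrightarrow> (\<forall>F\<in>set Fs. qf_over T F) \<and> qf_over T G"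
  by (induction Fs) auto

lemma sat_canonical_axiom:
  "sat K s (canonical_axiom k P) \<longleftrightarrow>
     ((\<exists>i j. i < j \<and> j < k \<and> s i = s j) \<longrightarrow> map s [0..<k] \<notin> Rel K P)"
proof -
  have "sat K s (foldr Disj Fs G) \<longleftrightarrow> (\<exists>F\<in>set Fs. sat K s F) \<or> sat K s G" for Fs G
    by (induction Fs) auto
  then show ?thesis by (fastforce simp: canonical_axiom_def)
qed

lemma canonical_hypergraph_theory: "l \<ge> 1 \<Longrightarrow> canonical_theory (hypergraph_theory l)"
  by (auto simp: canonical_theory_def hypergraph_theory_def canonical_axiom_def qf_over_foldr_Disj)

lemma map_qf_canonical_axiom: "map_qf f (canonical_axiom k P) = canonical_axiom k (f P)"
proof -
  have "map_qf f (foldr Disj Fs G) = foldr Disj (map (map_qf f) Fs) (map_qf f G)" for Fs G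
    by (induction Fs) auto
  then show ?thesis by (simp add: canonical_axiom_def map_concat o_def)
qed

lemma canonical_disjoint_union:
  fixes T1 :: "'p fo_theory" and T2 :: "'q fo_theory"
  assumes "canonical_theory T1" "canonical_theory T2"
  shows "canonical_theory (disjoint_union T1 T2)"
proof -
  let ?T = "disjoint_union T1 T2"
  have "qf_over ?T (map_qf Inl F)" if "qf_over T1 F" for F
    using that by (induction F) (auto simp: disjoint_union_def)
  moreover have "qf_over ?T (map_qf Inr F)" if "qf_over T2 F" for F
    using that by (induction F) (auto simp: disjoint_union_def)
  ultimately have "\<forall>F\<in>axioms ?T. qf_over ?T F"
    using assms by (auto simp: canonical_theory_def disjoint_union_def)
  moreover have "canonical_axiom (arity ?T Q) Q \<in> axioms ?T" if "Q \<in> preds ?T" for Q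
  proof (cases Q)
    case (Inl P)
    then have "canonical_axiom (arity T1 P) P \<in> axioms T1"
      using assms that by (auto simp: canonical_theory_def disjoint_union_def)
    from imageI[OF this, of "map_qf (Inl :: 'p \<Rightarrow> 'p + 'q)"] show ?thesis
      unfolding Inl map_qf_canonical_axiom by (simp add: disjoint_union_def)
  next
    case (Inr P)
    then have "canonical_axiom (arity T2 P) P \<in> axioms T2"
      using assms that by (auto simp: canonical_theory_def disjoint_union_def)
    from imageI[OF this, of "map_qf (Inr :: 'q \<Rightarrow> 'p + 'q)"] show ?thesis
      unfolding Inr map_qf_canonical_axiom by (simp add: disjoint_union_def)
  qed
  moreover have "finite (preds ?T)" "\<forall>Q\<in>preds ?T. arity ?T Q \<ge> 1"
    using assms by (auto simp: canonical_theory_def disjoint_union_def)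
  ultimately show ?thesis unfolding canonical_theory_def by blast
qed


section \<open>Isomorphism classes and limit objects\<close>

definition iso :: "('p, 'v) struct \<Rightarrow> ('p, 'w) struct \<Rightarrow> bool" where
  "iso M N \<longleftrightarrow> (\<exists>f. bij_betw f (vertices M) (vertices N) \<and> (\<forall>P. Rel N P = map f ` Rel M P))"

definition Aut :: "('p, 'v) struct \<Rightarrow> ('v \<Rightarrow> 'v) set" where
  "Aut K = {f. f permutes vertices K \<and> (\<forall>P. Rel K P = map f ` Rel K P)}"

definition induced :: "('p, 'v) struct \<Rightarrow> 'v set \<Rightarrow> ('p, 'v) struct" where
  "induced K U = \<lparr>vertices = U, Rel = (\<lambda>P. {xs \<in> Rel K P. set xs \<subseteq> U})\<rparr>"

text \<open>The isomorphism class of a finite structure is the set of its isomorphic copies on an initial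
  segment of the natural numbers.\<close>

type_synonym 'p iso_type = "('p, nat) struct set"

definition iso_class :: "('p, 'v) struct \<Rightarrow> 'p iso_type" where
  "iso_class K = {N. vertices N = {..<card (vertices K)} \<and> iso K N}"

definition models_n :: "'p fo_theory \<Rightarrow> nat \<Rightarrow> 'p iso_type set" where
  "models_n T n = iso_class ` {K :: ('p, nat) struct. is_model T K \<and> vertices K = {..<n}}"

definition models :: "'p fo_theory \<Rightarrow> 'p iso_type set" where
  "models T = (\<Union>n\<in>{1..}. models_n T n)"

definition rep :: "'p iso_type \<Rightarrow> ('p, nat) struct" where
  "rep C = (SOME M. M \<in> C)"

definition iso_size :: "'p iso_type \<Rightarrow> nat" where
  "iso_size C = card (vertices (rep C))"

definition density :: "'p iso_type \<Rightarrow> ('p, 'v) struct \<Rightarrow> real" where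
  "density C N =
     real (card {U. U \<subseteq> vertices N \<and> card U = iso_size C \<and> iso (induced N U) (rep C)})
     / real (card (vertices N) choose iso_size C)"

text \<open>Limit objects are extensional functions, so that equality of limit objects is equality on
  \<open>models T\<close>.\<close>

definition Hom_plus :: "'p fo_theory \<Rightarrow> ('p iso_type \<Rightarrow> real) set" where
  "Hom_plus T = {\<phi> \<in> models T \<rightarrow>\<^sub>E {0..1}.
     \<exists>N :: nat \<Rightarrow> ('p, nat) struct.
       (\<forall>n. is_model T (N n) \<and> finite (vertices (N n))) \<and>
       strict_mono (\<lambda>n. card (vertices (N n))) \<and>
       (\<forall>C\<in>models T. (\<lambda>n. density C (N n)) \<longlonglongrightarrow> \<phi> C)}"

definition labelled_density :: "('p iso_type \<Rightarrow> real) \<Rightarrow> ('p, 'v) struct \<Rightarrow> real" where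
  "labelled_density \<phi> K =
     real (card (Aut K)) / fact (card (vertices K)) * \<phi> (iso_class K)"


section \<open>Theons, rank and independence\<close>

definition atomless :: "'x measure \<Rightarrow> bool" where
  "atomless \<Omega> \<longleftrightarrow> (\<forall>A\<in>sets \<Omega>. emeasure \<Omega> A > 0 \<longrightarrow>
     (\<exists>B\<in>sets \<Omega>. B \<subseteq> A \<and> 0 < emeasure \<Omega> B \<and> emeasure \<Omega> B < emeasure \<Omega> A))"

definition fin_subsets :: "'v set \<Rightarrow> 'v set set" where
  "fin_subsets V = {A. A \<subseteq> V \<and> finite A \<and> A \<noteq> {}}"

definition fin_subsets_le :: "'v set \<Rightarrow> nat \<Rightarrow> 'v set set" where
  "fin_subsets_le V l = {A \<in> fin_subsets V. card A \<le> l}"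

definition fin_subsets_gt :: "'v set \<Rightarrow> nat \<Rightarrow> 'v set set" where
  "fin_subsets_gt V l = {A \<in> fin_subsets V. card A > l}"

definition E_space :: "'x measure \<Rightarrow> 'v set \<Rightarrow> ('v set \<Rightarrow> 'x) measure" where
  "E_space \<Omega> V = PiM (fin_subsets V) (\<lambda>_. \<Omega>)"

definition E_space_le :: "'x measure \<Rightarrow> 'v set \<Rightarrow> nat \<Rightarrow> ('v set \<Rightarrow> 'x) measure" where
  "E_space_le \<Omega> V l = PiM (fin_subsets_le V l) (\<lambda>_. \<Omega>)"

definition pull_index :: "'v list \<Rightarrow> ('v set \<Rightarrow> 'x) \<Rightarrow> (nat set \<Rightarrow> 'x)" where
  "pull_index xs \<theta> = (\<lambda>A\<in>fin_subsets {..<length xs}. \<theta> ((\<lambda>i. xs ! i) ` A))"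

type_synonym ('p, 'x) peons = "'p \<Rightarrow> (nat set \<Rightarrow> 'x) set"

definition exchangeable_array ::
    "'p fo_theory \<Rightarrow> ('p, 'x) peons \<Rightarrow> (nat set \<Rightarrow> 'x) \<Rightarrow> ('p, nat) struct" where
  "exchangeable_array T \<N> \<theta> =
     \<lparr>vertices = UNIV,
      Rel = (\<lambda>P. {xs. P \<in> preds T \<and> length xs = arity T P \<and> distinct xs \<and>
                      pull_index xs \<theta> \<in> \<N> P})\<rparr>"

definition theon :: "'p fo_theory \<Rightarrow> 'x measure \<Rightarrow> ('p, 'x) peons \<Rightarrow> bool" where
  "theon T \<Omega> \<N> \<longleftrightarrow>
     prob_space \<Omega> \<and> complete_measure \<Omega> \<and> atomless \<Omega> \<and>
     (\<forall>P\<in>preds T. \<N> P \<in> sets (E_space \<Omega> {..<arity T P})) \<and>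
     (AE \<theta> in E_space \<Omega> UNIV. is_model T (exchangeable_array T \<N> \<theta>))"

definition theon_limit ::
    "'p fo_theory \<Rightarrow> 'x measure \<Rightarrow> ('p, 'x) peons \<Rightarrow> 'p iso_type \<Rightarrow> real" where
  "theon_limit T \<Omega> \<N> = (\<lambda>C\<in>models T.
     \<P>(\<theta> in E_space \<Omega> UNIV.
        iso (induced (exchangeable_array T \<N> \<theta>) {..<iso_size C}) (rep C)))"

text \<open>In the next two definitions a product over complementary sets of coordinates is identified
  with the product over all coordinates: membership in a cylinder is tested on the restriction to
  the coordinates of its base.\<close>

definition peon_rank_le :: "'x measure \<Rightarrow> nat \<Rightarrow> (nat set \<Rightarrow> 'x) set \<Rightarrow> nat \<Rightarrow> bool" where
  "peon_rank_le \<Omega> k S r \<longleftrightarrow>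
     (\<exists>H\<in>sets (E_space_le \<Omega> {..<k} r).
        S = {x \<in> space (E_space \<Omega> {..<k}). restrict x (fin_subsets_le {..<k} r) \<in> H})"

definition peon_independent :: "'x measure \<Rightarrow> nat \<Rightarrow> (nat set \<Rightarrow> 'x) set \<Rightarrow> nat \<Rightarrow> bool" where
  "peon_independent \<Omega> k S l \<longleftrightarrow>
     (\<exists>H \<subseteq> fin_subsets_gt {..<k} l \<rightarrow>\<^sub>E space \<Omega>.
        S = {x \<in> space (E_space \<Omega> {..<k}). restrict x (fin_subsets_gt {..<k} l) \<in> H})"

definition peon_rank :: "'x measure \<Rightarrow> nat \<Rightarrow> (nat set \<Rightarrow> 'x) set \<Rightarrow> nat" where
  "peon_rank \<Omega> k S = (LEAST r. peon_rank_le \<Omega> k S r)"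

text \<open>The supremum over an empty language is 0.\<close>

definition theon_rank :: "'p fo_theory \<Rightarrow> 'x measure \<Rightarrow> ('p, 'x) peons \<Rightarrow> nat" where
  "theon_rank T \<Omega> \<N> = (SUP P\<in>preds T. peon_rank \<Omega> (arity T P) (\<N> P))"

text \<open>The representing theons range over all atomless complete probability spaces on the type
  \<open>'x\<close>, which is a parameter because a definition cannot quantify over types.\<close>

definition rk :: "'x itself \<Rightarrow> 'p fo_theory \<Rightarrow> ('p iso_type \<Rightarrow> real) \<Rightarrow> enat" where
  "rk _ T \<phi> = Inf {enat (theon_rank T \<Omega> \<N>) |(\<Omega> :: 'x measure) \<N>.
                   theon T \<Omega> \<N> \<and> theon_limit T \<Omega> \<N> = \<phi>}"

definition Independence ::
    "'x itself \<Rightarrow> 'p fo_theory \<Rightarrow> ('p iso_type \<Rightarrow> real) \<Rightarrow> nat \<Rightarrow> bool" where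
  "Independence _ T \<phi> l \<longleftrightarrow>
     (\<exists>(\<Omega> :: 'x measure) \<N>. theon T \<Omega> \<N> \<and> theon_limit T \<Omega> \<N> = \<phi> \<and>
        (\<forall>P\<in>preds T. peon_independent \<Omega> (arity T P) (\<N> P) l))"


section \<open>Open interpretations and couplings\<close>

definition interpret_struct ::
    "'p fo_theory \<Rightarrow> ('p \<Rightarrow> 'q qf) \<Rightarrow> ('q, 'v) struct \<Rightarrow> ('p, 'v) struct" where
  "interpret_struct T1 I K =
     \<lparr>vertices = vertices K,
      Rel = (\<lambda>P. {xs. P \<in> preds T1 \<and> length xs = arity T1 P \<and> set xs \<subseteq> vertices K \<and>
                      sat K (\<lambda>i. xs ! i) (I P)})\<rparr>"

text \<open>Models over the natural numbers suffice here: the theories are universal and formulas have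
  finitely many variables.\<close>

definition open_interpretation ::
    "'p fo_theory \<Rightarrow> 'q fo_theory \<Rightarrow> ('p \<Rightarrow> 'q qf) \<Rightarrow> bool" where
  "open_interpretation T1 T2 I \<longleftrightarrow>
     (\<forall>P\<in>preds T1. qf_over T2 (I P) \<and> qf_vars (I P) \<subseteq> {..<arity T1 P}) \<and>
     (\<forall>K :: ('q, nat) struct. is_model T2 K \<longrightarrow> is_model T1 (interpret_struct T1 I K))"

definition pullback ::
    "'p fo_theory \<Rightarrow> 'q fo_theory \<Rightarrow> ('p \<Rightarrow> 'q qf) \<Rightarrow> ('q iso_type \<Rightarrow> real) \<Rightarrow> 'p iso_type \<Rightarrow> real"
  where
  "pullback T1 T2 I \<phi> = (\<lambda>C\<in>models T1.
     \<Sum>D | D \<in> models_n T2 (iso_size C) \<and> iso (interpret_struct T1 I (rep D)) (rep C). \<phi> D)"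

definition erase_left :: "'p fo_theory \<Rightarrow> 'p \<Rightarrow> ('p + 'q) qf" where
  "erase_left T1 P = Atom (Inl P) [0..<arity T1 P]"

definition erase_right :: "'q fo_theory \<Rightarrow> 'q \<Rightarrow> ('p + 'q) qf" where
  "erase_right T2 Q = Atom (Inr Q) [0..<arity T2 Q]"

definition left_part :: "'p fo_theory \<Rightarrow> ('p + 'q, 'v) struct \<Rightarrow> ('p, 'v) struct" where
  "left_part T1 = interpret_struct T1 (erase_left T1)"

definition right_part :: "'q fo_theory \<Rightarrow> ('p + 'q, 'v) struct \<Rightarrow> ('q, 'v) struct" where
  "right_part T2 = interpret_struct T2 (erase_right T2)"

lemma map_nth_vars:
  assumes "length xs = n" shows "map (\<lambda>i. xs ! i) [0..<n] = xs"
  using assms map_nth by blast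

lemma sat_left_part:
  assumes "qf_over T1 F" "range s \<subseteq> vertices K"
  shows "sat (left_part T1 K) s F \<longleftrightarrow> sat K s (map_qf Inl F)"
  using assms
  by (induction F) (auto simp: left_part_def interpret_struct_def erase_left_def map_nth_vars)

lemma sat_right_part:
  assumes "qf_over T2 F" "range s \<subseteq> vertices K"
  shows "sat (right_part T2 K) s F \<longleftrightarrow> sat K s (map_qf Inr F)"
  using assms
  by (induction F) (auto simp: right_part_def interpret_struct_def erase_right_def map_nth_vars)

lemma open_interpretation_erase_left:
  assumes "canonical_theory T1"
  shows "open_interpretation T1 (disjoint_union T1 T2) (erase_left T1)"
  unfolding open_interpretation_def
proof (intro conjI ballI allI impI)
  fix K :: "(_, nat) struct"
  assume K: "is_model (disjoint_union T1 T2) K"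
  have "sat (left_part T1 K) s F" if "F \<in> axioms T1" "range s \<subseteq> vertices K" for F s
  proof -
    have "qf_over T1 F" using assms that by (simp add: canonical_theory_def)
    moreover have "sat K s (map_qf Inl F)"
      using K that by (simp add: is_model_def disjoint_union_def)
    ultimately show ?thesis using sat_left_part that by blast
  qed
  then show "is_model T1 (interpret_struct T1 (erase_left T1) K)"
    by (simp add: is_model_def left_part_def interpret_struct_def)
qed (auto simp: erase_left_def disjoint_union_def)

lemma open_interpretation_erase_right:
  assumes "canonical_theory T2"
  shows "open_interpretation T2 (disjoint_union T1 T2) (erase_right T2)"
  unfolding open_interpretation_def
proof (intro conjI ballI allI impI)
  fix K :: "(_, nat) struct"
  assume K: "is_model (disjoint_union T1 T2) K"
  have "sat (right_part T2 K) s F" if "F \<in> axioms T2" "range s \<subseteq> vertices K" for F s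
  proof -
    have "qf_over T2 F" using assms that by (simp add: canonical_theory_def)
    moreover have "sat K s (map_qf Inr F)"
      using K that by (simp add: is_model_def disjoint_union_def)
    ultimately show ?thesis using sat_right_part that by blast
  qed
  then show "is_model T2 (interpret_struct T2 (erase_right T2) K)"
    by (simp add: is_model_def right_part_def interpret_struct_def)
qed (auto simp: erase_right_def disjoint_union_def)

definition couplings ::
    "'p fo_theory \<Rightarrow> 'q fo_theory \<Rightarrow> ('p iso_type \<Rightarrow> real) \<Rightarrow> ('q iso_type \<Rightarrow> real) \<Rightarrow>
     (('p + 'q) iso_type \<Rightarrow> real) set" where
  "couplings T1 T2 \<phi>1 \<phi>2 =
     {\<xi> \<in> Hom_plus (disjoint_union T1 T2).
        pullback T1 (disjoint_union T1 T2) (erase_left T1) \<xi> = \<phi>1 \<and>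
        pullback T2 (disjoint_union T1 T2) (erase_right T2) \<xi> = \<phi>2}"

text \<open>The factor \<open>m! / |Aut M|\<close> turns the labelled density of the independent coupling,
  which is the product of the labelled densities of the two parts, into the unlabelled one.\<close>

definition indep_coupling ::
    "'p fo_theory \<Rightarrow> 'q fo_theory \<Rightarrow> ('p iso_type \<Rightarrow> real) \<Rightarrow> ('q iso_type \<Rightarrow> real) \<Rightarrow>
     ('p + 'q) iso_type \<Rightarrow> real" where
  "indep_coupling T1 T2 \<phi>1 \<phi>2 = (\<lambda>C\<in>models (disjoint_union T1 T2).
     fact (iso_size C) / real (card (Aut (rep C))) *
     (labelled_density \<phi>1 (left_part T1 (rep C)) * labelled_density \<phi>2 (right_part T2 (rep C))))"

definition uniquely_coupleable ::
    "'p fo_theory \<Rightarrow> 'q fo_theory \<Rightarrow> ('p iso_type \<Rightarrow> real) \<Rightarrow> ('q iso_type \<Rightarrow> real) \<Rightarrow> bool" where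
  "uniquely_coupleable T1 T2 \<phi>1 \<phi>2 \<longleftrightarrow>
     couplings T1 T2 \<phi>1 \<phi>2 = {indep_coupling T1 T2 \<phi>1 \<phi>2}"

text \<open>Languages being finite, every canonical theory is, up to renaming of predicate symbols, a
  theory whose symbols are natural numbers.\<close>

definition UCouple :: "'x itself \<Rightarrow> 'p fo_theory \<Rightarrow> ('p iso_type \<Rightarrow> real) \<Rightarrow> nat \<Rightarrow> bool" where
  "UCouple X T \<phi> l \<longleftrightarrow>
     (\<forall>T' :: nat fo_theory. canonical_theory T' \<longrightarrow>
        (\<forall>\<psi>\<in>Hom_plus T'. rk X T' \<psi> \<le> enat l \<longrightarrow> uniquely_coupleable T T' \<phi> \<psi>))"

definition complete_hypergraph :: "nat \<Rightarrow> (unit, 'v) struct \<Rightarrow> bool" where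
  "complete_hypergraph l H \<longleftrightarrow>
     Rel H () = {xs. length xs = l \<and> distinct xs \<and> set xs \<subseteq> vertices H}"

definition UInduce :: "'p fo_theory \<Rightarrow> ('p iso_type \<Rightarrow> real) \<Rightarrow> nat \<Rightarrow> bool" where
  "UInduce T \<phi> l \<longleftrightarrow>
     (l \<ge> 1 \<longrightarrow>
       (\<forall>\<psi>\<in>Hom_plus (hypergraph_theory l).
        \<forall>\<xi>\<in>couplings T (hypergraph_theory l) \<phi> \<psi>.
        \<forall>C\<in>models (disjoint_union T (hypergraph_theory l)).
          complete_hypergraph l (right_part (hypergraph_theory l) (rep C)) \<longrightarrow>
          \<xi> C = indep_coupling T (hypergraph_theory l) \<phi> \<psi> C))"

end

theory Submission
  imports Defs "HOL-Library.Diagonal_Subsequence"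
begin

text \<open>
  Only the claim on unique inducibility needs an argument. Write \<open>l = r + 1\<close> with \<open>r \<ge> 1\<close> and let
  finite models \<open>N\<^sub>k\<close> converge to a coupling of \<open>\<phi>\<close> with an \<open>r\<close>-hypergraph limit. For any
  \<open>R\<^sub>k \<subseteq> V(N\<^sub>k)\<close>, replace the \<open>r\<close>-hypergraph by the \<open>(r + 1)\<close>-hypergraph of those sets \<open>A\<close> for which
  \<open>A \<inter> R\<^sub>k\<close> is a clique. A set \<open>U\<close> of more than \<open>r\<close> vertices is complete in the new hypergraph iff
  \<open>U \<inter> R\<^sub>k\<close> is a clique in the old one, so along a convergent subsequence \<open>UInduce[r + 1]\<close> says that
  the isomorphism type induced on a random \<open>n\<close>-set \<open>U\<close> is asymptotically uncorrelated with the event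
  that \<open>U \<inter> R\<^sub>k\<close> is a clique, for every choice of \<open>R\<^sub>k\<close> and every \<open>n > r\<close>.

  The freedom in \<open>R\<^sub>k\<close> and \<open>n\<close> then yields the claim for cliques of every size \<open>m\<close>, including \<open>m \<le> r\<close>.
  Averaging over \<open>R\<close> with weights \<open>t\<^bsup>|R|\<^esup>\<close> and comparing coefficients of \<open>t\<close> gives that the
  number of \<open>m\<close>-subsets of \<open>U\<close> of a given type is uncorrelated with the number of \<open>m\<close>-cliques in \<open>U\<close>.
  Sorting the pairs of \<open>m\<close>-sets by the size \<open>s\<close> of their union makes this covariance a combination of
  the binomial coefficients \<open>n choose s\<close> with coefficients independent of \<open>n\<close>. So every coefficient
  tends to 0, and the one for \<open>s = m\<close>, where the two sets coincide, is the desired covariance.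
\<close>

section \<open>Averages over subsets\<close>

text \<open>The expectation of \<open>f\<close> at a uniformly random \<open>n\<close>-subset of
  \<open>V\<close>. For finite \<open>V\<close> with fewer than \<open>n\<close> elements the sum is
  empty and the value is 0.\<close>

definition subset_avg :: "'v set \<Rightarrow> nat \<Rightarrow> ('v set \<Rightarrow> real) \<Rightarrow> real" where
  "subset_avg V n f = (\<Sum>U | U \<subseteq> V \<and> card U = n. f U) / real (card V choose n)"

lemma subset_avg_cong:
  assumes "\<And>U. U \<subseteq> V \<Longrightarrow> card U = n \<Longrightarrow> f U = g U"
  shows "subset_avg V n f = subset_avg V n g"
  unfolding subset_avg_def using assms by (intro arg_cong2[where f="(/)"] sum.cong) auto

lemma subset_avg_sum: "subset_avg V n (\<lambda>U. \<Sum>i\<in>I. f i U) = (\<Sum>i\<in>I. subset_avg V n (f i))"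
  unfolding subset_avg_def by (subst sum.swap) (simp add: sum_divide_distrib)

lemma subset_avg_cmult: "subset_avg V n (\<lambda>U. c * f U) = c * subset_avg V n f"
  by (simp add: subset_avg_def sum_distrib_left)

lemma subset_avg_diff: "subset_avg V n (\<lambda>U. f U - g U) = subset_avg V n f - subset_avg V n g"
  by (simp add: subset_avg_def sum_subtractf diff_divide_distrib)

text \<open>Deleting \<open>S\<close> is a bijection onto the subsets of \<open>V - S\<close> of
  size \<open>n - card S\<close>.\<close>

lemma card_supersets:
  assumes "finite V" "S \<subseteq> V" "card S \<le> n"
  shows "card {U. S \<subseteq> U \<and> U \<subseteq> V \<and> card U = n} = (card V - card S) choose (n - card S)"
proof -
  have fS: "finite S" using assms finite_subset by blast
  have "bij_betw (\<lambda>U. U \<union> S) {U. U \<subseteq> V - S \<and> card U = n - card S}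
          {U. S \<subseteq> U \<and> U \<subseteq> V \<and> card U = n}"
  proof (rule bij_betw_byWitness[where f' = "\<lambda>U. U - S"])
    show "(\<lambda>U. U \<union> S) ` {U. U \<subseteq> V - S \<and> card U = n - card S} \<subseteq> {U. S \<subseteq> U \<and> U \<subseteq> V \<and> card U = n}"
    proof clarify
      fix U assume U: "U \<subseteq> V - S" "card U = n - card S"
      have "card (U \<union> S) = card U + card S"
        using U fS assms by (intro card_Un_disjoint) (auto intro: finite_subset)
      then show "S \<subseteq> U \<union> S \<and> U \<union> S \<subseteq> V \<and> card (U \<union> S) = n" using U assms by auto
    qed
    show "(\<lambda>U. U - S) ` {U. S \<subseteq> U \<and> U \<subseteq> V \<and> card U = n} \<subseteq> {U. U \<subseteq> V - S \<and> card U = n - card S}"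
      using fS by (auto simp: card_Diff_subset)
  qed auto
  then have "card {U. S \<subseteq> U \<and> U \<subseteq> V \<and> card U = n} = card {U. U \<subseteq> V - S \<and> card U = n - card S}"
    by (simp add: bij_betw_same_card)
  also have "\<dots> = (card V - card S) choose (n - card S)"
    using assms fS by (subst n_subsets) (auto simp: card_Diff_subset)
  finally show ?thesis .
qed

text \<open>Double counting: a uniform \<open>s\<close>-subset of a uniform \<open>n\<close>-subset
  of \<open>V\<close> is a uniform \<open>s\<close>-subset of \<open>V\<close>, and each
  \<open>n\<close>-set has \<open>n choose s\<close> subsets to choose from.\<close>

lemma subset_avg_sum_subsets:
  assumes "finite V" "n \<le> card V"
  shows "subset_avg V n (\<lambda>U. \<Sum>S | S \<subseteq> U \<and> card S = s. f S) = real (n choose s) * subset_avg V s f"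
proof (cases "s \<le> n")
  case True
  have "(\<Sum>U | U \<subseteq> V \<and> card U = n. \<Sum>S | S \<subseteq> U \<and> card S = s. f S) =
        (\<Sum>U | U \<subseteq> V \<and> card U = n. \<Sum>S | S \<in> {S. S \<subseteq> V \<and> card S = s} \<and> S \<subseteq> U. f S)"
    by (intro sum.cong) auto
  also have "\<dots> = (\<Sum>S | S \<subseteq> V \<and> card S = s. \<Sum>U | U \<in> {U. U \<subseteq> V \<and> card U = n} \<and> S \<subseteq> U. f S)"
    using assms by (intro sum.swap_restrict) auto
  \<comment> \<open>After the exchange of sums \<open>f S\<close> is weighted by the number of
    \<open>n\<close>-sets above \<open>S\<close>, which depends on \<open>s\<close> alone.\<close>
  also have "\<dots> = (\<Sum>S | S \<subseteq> V \<and> card S = s. real ((card V - s) choose (n - s)) * f S)"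
  proof (intro sum.cong refl)
    fix S assume "S \<in> {S. S \<subseteq> V \<and> card S = s}"
    then have S: "S \<subseteq> V" "card S = s" by auto
    have "{U. U \<in> {U. U \<subseteq> V \<and> card U = n} \<and> S \<subseteq> U} = {U. S \<subseteq> U \<and> U \<subseteq> V \<and> card U = n}" by auto
    then show "(\<Sum>U | U \<in> {U. U \<subseteq> V \<and> card U = n} \<and> S \<subseteq> U. f S) = real ((card V - s) choose (n - s)) * f S"
      using card_supersets[of V S n] S assms True by simp
  qed
  finally have *: "(\<Sum>U | U \<subseteq> V \<and> card U = n. \<Sum>S | S \<subseteq> U \<and> card S = s. f S) =
     real ((card V - s) choose (n - s)) * (\<Sum>S | S \<subseteq> V \<and> card S = s. f S)"
    by (simp add: sum_distrib_left)
  have "real (card V choose n) * real (n choose s) = real (card V choose s) * real ((card V - s) choose (n - s))"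
    using choose_mult[OF True assms(2)] by (metis of_nat_mult)
  moreover have "card V choose n > 0" "card V choose s > 0" using assms True by auto
  ultimately show ?thesis
    unfolding subset_avg_def * by (simp add: field_simps)
next
  case False
  have "subset_avg V n (\<lambda>U. \<Sum>S | S \<subseteq> U \<and> card S = s. f S) = subset_avg V n (\<lambda>U. 0)"
  proof (rule subset_avg_cong)
    fix U assume U: "U \<subseteq> V" "card U = n"
    then have "{S. S \<subseteq> U \<and> card S = s} = {}"
      using False card_mono[OF finite_subset[OF U(1) assms(1)]] by auto
    then show "(\<Sum>S | S \<subseteq> U \<and> card S = s. f S) = 0" by (simp only: sum.empty)
  qed
  then show ?thesis using False by (simp add: subset_avg_def binomial_eq_0)
qed

section \<open>Extracting coefficients from pointwise limits\<close>

text \<open>The coefficients of a polynomial of bounded degree are fixed linear combinations of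
  finitely many of its values. Induction on the degree removes the top coefficient by comparing the
  values at \<open>t\<close> and \<open>2 * t\<close>.\<close>

lemma tendsto_0_poly_coeffs:
  fixes e :: "nat \<Rightarrow> nat \<Rightarrow> real"
  assumes "\<And>t. t > 0 \<Longrightarrow> (\<lambda>k. \<Sum>i\<le>n. t ^ i * e i k) \<longlonglongrightarrow> 0" and "i \<le> n"
  shows "e i \<longlonglongrightarrow> 0"
  using assms
proof (induction n arbitrary: e i)
  case 0
  then show ?case using "0.prems"(1)[of 1] by simp
next
  case (Suc n)
  let ?c = "\<lambda>i. 2 ^ i - 2 ^ Suc n :: real"
  have low: "e i \<longlonglongrightarrow> 0" if "i \<le> n" for i
  proof -
    \<comment> \<open>\<open>p (2 * t) - 2 ^ Suc n * p t\<close> has lost the top coefficient of \<open>p\<close>.\<close>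
    have "(\<lambda>k. \<Sum>i\<le>n. t ^ i * (?c i * e i k)) \<longlonglongrightarrow> 0" if "t > 0" for t
    proof -
      have "(\<lambda>k. (\<Sum>i\<le>Suc n. (2 * t) ^ i * e i k) - 2 ^ Suc n * (\<Sum>i\<le>Suc n. t ^ i * e i k)) \<longlonglongrightarrow> 0 - 2 ^ Suc n * 0"
        using that Suc.prems(1)[of t] Suc.prems(1)[of "2 * t"]
        by (intro tendsto_diff tendsto_mult tendsto_const) auto
      moreover have "(\<Sum>i\<le>Suc n. (2 * t) ^ i * e i k) - 2 ^ Suc n * (\<Sum>i\<le>Suc n. t ^ i * e i k)
          = (\<Sum>i\<le>n. t ^ i * (?c i * e i k))" for k
      proof -
        have "(\<Sum>i\<le>Suc n. (2 * t) ^ i * e i k) - 2 ^ Suc n * (\<Sum>i\<le>Suc n. t ^ i * e i k)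
          = (\<Sum>i\<le>Suc n. t ^ i * (?c i * e i k))"
          unfolding sum_distrib_left sum_subtractf[symmetric]
          by (intro sum.cong refl) (simp add: power_mult_distrib algebra_simps)
        then show ?thesis by simp
      qed
      ultimately show ?thesis by simp
    qed
    then have "(\<lambda>k. ?c i * e i k) \<longlonglongrightarrow> 0"
      using Suc.IH[of "\<lambda>i k. ?c i * e i k" i] that by blast
    then have "(\<lambda>k. inverse (?c i) * (?c i * e i k)) \<longlonglongrightarrow> inverse (?c i) * 0"
      by (intro tendsto_mult tendsto_const)
    moreover have "?c i \<noteq> 0"
      using power_strict_increasing[of i "Suc n" "2::real"] that by simp
    ultimately show ?thesis by (simp add: mult.assoc[symmetric])
  qed
  \<comment> \<open>At \<open>t = 1\<close> all powers are 1, so subtracting the lower coefficients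
    leaves the top one.\<close>
  have "(\<lambda>k. (\<Sum>i\<le>Suc n. 1 ^ i * e i k) - (\<Sum>i\<le>n. e i k)) \<longlonglongrightarrow> 0 - (\<Sum>i\<le>n. 0)"
    using low by (intro tendsto_diff tendsto_sum Suc.prems(1)) auto
  then have "e (Suc n) \<longlonglongrightarrow> 0" by simp
  then show ?case using low Suc.prems(2) le_SucE by metis
qed

text \<open>By Pascal's rule the forward difference in \<open>N\<close> turns the coefficient
  sequence \<open>d\<close> into its shift, with one summand fewer. Induction handles the shifted
  coefficients, and the single value \<open>N = b\<close> then gives \<open>d 0\<close>.\<close>

lemma tendsto_0_binomial_coeffs:
  fixes d :: "nat \<Rightarrow> nat \<Rightarrow> real"
  assumes "\<And>N. N \<ge> b \<Longrightarrow> (\<lambda>k. \<Sum>i\<le>m. real (N choose i) * d i k) \<longlonglongrightarrow> 0" and "i \<le> m"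
  shows "d i \<longlonglongrightarrow> 0"
  using assms
proof (induction m arbitrary: d i)
  case 0
  then show ?case using "0.prems"(1)[of b] by simp
next
  case (Suc m)
  have high: "d (Suc i) \<longlonglongrightarrow> 0" if "i \<le> m" for i
  proof (rule Suc.IH[of "\<lambda>i. d (Suc i)"])
    fix N assume N: "N \<ge> b"
    have "(\<lambda>k. (\<Sum>i\<le>Suc m. real (Suc N choose i) * d i k) - (\<Sum>i\<le>Suc m. real (N choose i) * d i k)) \<longlonglongrightarrow> 0 - 0"
      using N by (intro tendsto_diff Suc.prems(1)) auto
    moreover have "(\<Sum>i\<le>Suc m. real (Suc N choose i) * d i k) - (\<Sum>i\<le>Suc m. real (N choose i) * d i k)
        = (\<Sum>i\<le>m. real (N choose i) * d (Suc i) k)" for k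
      unfolding sum_subtractf[symmetric] sum.atMost_Suc_shift
      by (simp add: algebra_simps sum.distrib)
    ultimately show "(\<lambda>k. \<Sum>i\<le>m. real (N choose i) * d (Suc i) k) \<longlonglongrightarrow> 0" by simp
  qed (fact that)
  have "(\<lambda>k. (\<Sum>i\<le>Suc m. real (b choose i) * d i k) - (\<Sum>i\<le>m. real (b choose Suc i) * d (Suc i) k))
      \<longlonglongrightarrow> 0 - (\<Sum>i\<le>m. real (b choose Suc i) * 0)"
    using high by (intro tendsto_diff tendsto_sum tendsto_mult tendsto_const Suc.prems(1)) auto
  then have "d 0 \<longlonglongrightarrow> 0" unfolding sum.atMost_Suc_shift by simp
  then show ?case using high Suc.prems(2) by (cases i) auto
qed

section \<open>Sums over subsets and pairs of subsets\<close>

text \<open>\<open>R\<close> splits into \<open>R - U\<close> and \<open>R \<inter> U\<close>,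
  chosen independently. The part outside \<open>U\<close> does not affect \<open>g\<close>, and its
  weights add up to a power of \<open>1 + t\<close>.\<close>

lemma sum_power_card_Int:
  fixes t :: real and g :: "'v set \<Rightarrow> real"
  assumes "finite V" "U \<subseteq> V"
  shows "(\<Sum>R\<in>Pow V. t ^ card R * g (R \<inter> U)) =
         (1 + t) ^ (card V - card U) * (\<Sum>R\<in>Pow U. t ^ card R * g R)"
proof -
  have fU: "finite U" using assms finite_subset by blast
  have "(\<Sum>R\<in>Pow V. t ^ card R * g (R \<inter> U)) =
        (\<Sum>(S, R)\<in>Pow (V - U) \<times> Pow U. t ^ card S * (t ^ card R * g R))"
  proof (rule sum.reindex_bij_witness[where i = "\<lambda>(S, R). S \<union> R" and j = "\<lambda>R. (R - U, R \<inter> U)"])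
    fix R assume "R \<in> Pow V"
    then have "card (R - U) + card (R \<inter> U) = card R"
      using assms by (subst card_Un_disjoint[symmetric]) (auto intro: finite_subset arg_cong[where f=card])
    then have "t ^ card (R - U) * t ^ card (R \<inter> U) = t ^ card R" by (simp flip: power_add)
    then show "(case (R - U, R \<inter> U) of (S, R) \<Rightarrow> t ^ card S * (t ^ card R * g R)) = t ^ card R * g (R \<inter> U)"
      by (simp flip: mult.assoc)
  qed (use assms in auto)
  also have "\<dots> = (\<Sum>S\<in>Pow (V - U). t ^ card S) * (\<Sum>R\<in>Pow U. t ^ card R * g R)"
    by (simp add: sum_product sum.cartesian_product)
  also have "(\<Sum>S\<in>Pow (V - U). t ^ card S) = (1 + t) ^ (card V - card U)"
    using prod_add[of "V - U" "\<lambda>_. t" "\<lambda>_. 1"] assms fU by (simp add: card_Diff_subset add.commute)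
  finally show ?thesis .
qed

lemma sum_Pow_by_card:
  assumes "finite U"
  shows "(\<Sum>R\<in>Pow U. f R) = (\<Sum>i\<le>card U. \<Sum>R | R \<subseteq> U \<and> card R = i. f R)"
proof -
  have "(\<Sum>R\<in>Pow U. f R) = (\<Sum>i\<le>card U. \<Sum>R | R \<in> Pow U \<and> card R = i. f R)"
    using assms by (intro sum.group[symmetric]) (auto intro: card_mono)
  then show ?thesis by (simp add: Pow_def)
qed


text \<open>Two \<open>m\<close>-sets have a union of size at most \<open>2 * m\<close>. The
  innermost sum on the right depends on \<open>S\<close> alone and not on \<open>U\<close>, so
  averaging over \<open>U\<close> affects only the sum over \<open>S\<close>.\<close>

lemma sum_pairs_by_union:
  fixes f :: "'v set \<Rightarrow> real"
  assumes "finite U"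
  shows "(\<Sum>W | W \<subseteq> U \<and> card W = m. \<Sum>R | R \<subseteq> U \<and> card R = m. f W * g R) =
         (\<Sum>s\<le>2 * m. \<Sum>S | S \<subseteq> U \<and> card S = s.
            \<Sum>(W, R) | card W = m \<and> card R = m \<and> W \<union> R = S. f W * g R)"
proof -
  let ?P = "{(W, R). W \<subseteq> U \<and> R \<subseteq> U \<and> card W = m \<and> card R = m}"
  let ?u = "\<lambda>(W, R). W \<union> R"
  let ?h = "\<lambda>(W, R). f W * g R"
  let ?S = "{S. S \<subseteq> U \<and> card S \<le> 2 * m}"
  have fin: "finite {W. W \<subseteq> U \<and> card W = m}" "finite ?S" using assms by auto
  have P: "?P = {W. W \<subseteq> U \<and> card W = m} \<times> {W. W \<subseteq> U \<and> card W = m}" by auto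
  have img: "?u ` ?P \<subseteq> ?S"
  proof clarify
    fix W R assume "W \<subseteq> U" "R \<subseteq> U" "m = card W" "card R = card W"
    then show "W \<union> R \<subseteq> U \<and> card (W \<union> R) \<le> 2 * card W"
      using card_Un_le[of W R] by auto
  qed
  have "(\<Sum>W | W \<subseteq> U \<and> card W = m. \<Sum>R | R \<subseteq> U \<and> card R = m. f W * g R) = (\<Sum>p\<in>?P. ?h p)"
    unfolding P by (simp add: sum.cartesian_product)
  also have "\<dots> = (\<Sum>S\<in>?S. \<Sum>p | p \<in> ?P \<and> ?u p = S. ?h p)"
    by (rule sum.group[symmetric]) (use fin img P in auto)
  also have "\<dots> = (\<Sum>S\<in>?S. \<Sum>(W, R) | card W = m \<and> card R = m \<and> W \<union> R = S. f W * g R)"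
    by (intro sum.cong refl) auto
  also have "\<dots> = (\<Sum>s\<le>2 * m. \<Sum>S | S \<in> ?S \<and> card S = s.
      \<Sum>(W, R) | card W = m \<and> card R = m \<and> W \<union> R = S. f W * g R)"
    by (rule sum.group[symmetric]) (use fin in auto)
  also have "\<dots> = (\<Sum>s\<le>2 * m. \<Sum>S | S \<subseteq> U \<and> card S = s.
      \<Sum>(W, R) | card W = m \<and> card R = m \<and> W \<union> R = S. f W * g R)"
    by (intro sum.cong) auto
  finally show ?thesis .
qed

section \<open>Removing the restricting sets\<close>

text \<open>The combinatorial core, stated without structures. In the application \<open>h k\<close>
  is the centred indicator of an isomorphism type and \<open>g k\<close> the indicator of cliques;
  the bound \<open>b\<close> allows for information on large sets \<open>U\<close> only, while
  \<open>m\<close> may be smaller.\<close>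

lemma clique_decoupling:
  fixes h g :: "nat \<Rightarrow> 'v set \<Rightarrow> real"
  assumes fin: "\<And>k. finite (V k)"
    and size: "filterlim (\<lambda>k. card (V k)) at_top sequentially"
    and restr: "\<And>n R. n \<ge> b \<Longrightarrow> (\<And>k. R k \<subseteq> V k) \<Longrightarrow>
      (\<lambda>k. subset_avg (V k) n (\<lambda>U. (\<Sum>W | W \<subseteq> U \<and> card W = m. h k W) * g k (R k \<inter> U))) \<longlonglongrightarrow> 0"
  shows "(\<lambda>k. subset_avg (V k) m (\<lambda>W. h k W * g k W)) \<longlonglongrightarrow> 0"
proof -
  define w where "w k U = (\<Sum>W | W \<subseteq> U \<and> card W = m. h k W)" for k U
  define F where "F k n R = subset_avg (V k) n (\<lambda>U. w k U * g k (R \<inter> U))" for k n R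
  have weighted: "(\<lambda>k. subset_avg (V k) n (\<lambda>U. w k U * (\<Sum>R\<in>Pow U. t ^ card R * g k R))) \<longlonglongrightarrow> 0"
    (is "?G \<longlonglongrightarrow> 0") if "n \<ge> b" "t > 0" for n and t :: real
  proof -
    \<comment> \<open>For each \<open>k\<close> a set \<open>R\<close> maximising the absolute value
      of \<open>F k n R\<close> is chosen. The assumption on this one sequence then controls all
      subsets of \<open>V k\<close> uniformly, hence also their weighted sum.\<close>
    have "\<exists>R\<in>Pow (V k). \<forall>R'\<in>Pow (V k). \<bar>F k n R'\<bar> \<le> \<bar>F k n R\<bar>" for k
    proof -
      have "Max ((\<lambda>R. \<bar>F k n R\<bar>) ` Pow (V k)) \<in> (\<lambda>R. \<bar>F k n R\<bar>) ` Pow (V k)"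
        using fin by (intro Max_in) auto
      then obtain R where "R \<in> Pow (V k)" "\<bar>F k n R\<bar> = Max ((\<lambda>R. \<bar>F k n R\<bar>) ` Pow (V k))"
        unfolding image_iff by (elim bexE) (rule that, simp_all)
      then show ?thesis using fin by (intro bexI[of _ R]) auto
    qed
    then obtain R where R: "\<And>k. R k \<subseteq> V k" "\<And>k R'. R' \<subseteq> V k \<Longrightarrow> \<bar>F k n R'\<bar> \<le> \<bar>F k n (R k)\<bar>"
      by (metis Pow_iff)
    have lim: "(\<lambda>k. (1 + t) ^ n * \<bar>F k n (R k)\<bar>) \<longlonglongrightarrow> (1 + t) ^ n * 0"
      using restr[OF that(1) R(1)] unfolding F_def w_def
      by (intro tendsto_mult tendsto_const tendsto_rabs_zero)
    have "norm (?G k) \<le> (1 + t) ^ n * \<bar>F k n (R k)\<bar>" for k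
    proof -
      let ?v = "card (V k)"
      \<comment> \<open>The weighted sum of \<open>F k n R\<close> is a power of
        \<open>1 + t\<close> times \<open>?G k\<close>, since each \<open>U\<close> sees
        \<open>R\<close> only through \<open>R \<inter> U\<close>.\<close>
      have "(\<Sum>R\<in>Pow (V k). t ^ card R * F k n R) =
            subset_avg (V k) n (\<lambda>U. \<Sum>R\<in>Pow (V k). t ^ card R * (w k U * g k (R \<inter> U)))"
        unfolding F_def by (simp add: subset_avg_sum subset_avg_cmult)
      also have "\<dots> = subset_avg (V k) n (\<lambda>U. (1 + t) ^ (?v - n) *
          (w k U * (\<Sum>R\<in>Pow U. t ^ card R * g k R)))"
      proof (rule subset_avg_cong)
        fix U assume U: "U \<subseteq> V k" "card U = n"
        have "(\<Sum>R\<in>Pow (V k). t ^ card R * (w k U * g k (R \<inter> U)))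
          = w k U * (\<Sum>R\<in>Pow (V k). t ^ card R * g k (R \<inter> U))"
          by (simp add: sum_distrib_left mult.left_commute)
        then show "(\<Sum>R\<in>Pow (V k). t ^ card R * (w k U * g k (R \<inter> U))) =
           (1 + t) ^ (?v - n) * (w k U * (\<Sum>R\<in>Pow U. t ^ card R * g k R))"
          using sum_power_card_Int[OF fin U(1)] U(2) by simp
      qed
      also have "\<dots> = (1 + t) ^ (?v - n) * ?G k" by (rule subset_avg_cmult)
      finally have "(1 + t) ^ (?v - n) * \<bar>?G k\<bar> = \<bar>\<Sum>R\<in>Pow (V k). t ^ card R * F k n R\<bar>"
        using that by (simp add: abs_mult)
      also have "\<dots> \<le> (\<Sum>R\<in>Pow (V k). \<bar>t ^ card R * F k n R\<bar>)" by (rule sum_abs)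
      also have "\<dots> \<le> (\<Sum>R'\<in>Pow (V k). t ^ card R' * \<bar>F k n (R k)\<bar>)"
        using R(2) that by (intro sum_mono) (auto simp: abs_mult)
      also have "\<dots> = (1 + t) ^ ?v * \<bar>F k n (R k)\<bar>"
        using prod_add[of "V k" "\<lambda>_. t" "\<lambda>_. 1"] fin
        by (simp add: add.commute flip: sum_distrib_right)
      \<comment> \<open>An inequality rather than an equality because the subtraction is truncated
        when \<open>?v < n\<close>. Cancelling the common power leaves the factor
        \<open>(1 + t) ^ n\<close>, which is constant in \<open>k\<close>.\<close>
      also have "\<dots> \<le> (1 + t) ^ (?v - n + n) * \<bar>F k n (R k)\<bar>"
        using that by (intro mult_right_mono power_increasing) auto
      finally show ?thesis using that by (simp add: power_add mult.assoc)
    qed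
    then have "eventually (\<lambda>k. norm (?G k) \<le> (1 + t) ^ n * \<bar>F k n (R k)\<bar>) sequentially"
      by (rule always_eventually[OF allI])
    from Lim_null_comparison[OF this lim[unfolded mult_zero_right]] show ?thesis .
  qed
  define e where "e n i k = subset_avg (V k) n (\<lambda>U. w k U * (\<Sum>R | R \<subseteq> U \<and> card R = i. g k R))" for n i k
  \<comment> \<open>\<open>e n m\<close> is the coefficient of \<open>t ^ m\<close> in a polynomial
    of degree \<open>n\<close>, whence \<open>n \<ge> m\<close> besides
    \<open>n \<ge> b\<close>.\<close>
  have e: "e n m \<longlonglongrightarrow> 0" if "n \<ge> max b m" for n
  proof (rule tendsto_0_poly_coeffs[where n = n])
    fix t :: real assume "t > 0"
    moreover have "subset_avg (V k) n (\<lambda>U. w k U * (\<Sum>R\<in>Pow U. t ^ card R * g k R))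
        = (\<Sum>i\<le>n. t ^ i * e n i k)" for k
    proof -
      have "subset_avg (V k) n (\<lambda>U. w k U * (\<Sum>R\<in>Pow U. t ^ card R * g k R)) =
            subset_avg (V k) n (\<lambda>U. \<Sum>i\<le>n. t ^ i * (w k U * (\<Sum>R | R \<subseteq> U \<and> card R = i. g k R)))"
      proof (rule subset_avg_cong)
        fix U assume U: "U \<subseteq> V k" "card U = n"
        then have "(\<Sum>R\<in>Pow U. t ^ card R * g k R) = (\<Sum>i\<le>n. \<Sum>R | R \<subseteq> U \<and> card R = i. t ^ card R * g k R)"
          using sum_Pow_by_card[OF finite_subset[OF U(1) fin], of "\<lambda>R. t ^ card R * g k R"] by simp
        also have "\<dots> = (\<Sum>i\<le>n. t ^ i * (\<Sum>R | R \<subseteq> U \<and> card R = i. g k R))"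
          by (simp add: sum_distrib_left)
        finally show "w k U * (\<Sum>R\<in>Pow U. t ^ card R * g k R) =
            (\<Sum>i\<le>n. t ^ i * (w k U * (\<Sum>R | R \<subseteq> U \<and> card R = i. g k R)))"
          by (simp add: sum_distrib_left mult.left_commute)
      qed
      then show ?thesis unfolding e_def by (simp add: subset_avg_sum subset_avg_cmult)
    qed
    ultimately show "(\<lambda>k. \<Sum>i\<le>n. t ^ i * e n i k) \<longlonglongrightarrow> 0"
      using weighted[of n t] that by simp
  qed (use that in simp)
  define f where "f k S = (\<Sum>(W, R) | card W = m \<and> card R = m \<and> W \<union> R = S. h k W * g k R)" for k S
  define d where "d s k = subset_avg (V k) s (f k)" for s k
  \<comment> \<open>\<open>e n m\<close> is eventually a combination of the \<open>d s\<close> with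
    weights \<open>n choose s\<close>, and \<open>d s\<close> is independent of \<open>n\<close>; so
    letting \<open>n\<close> vary isolates each \<open>d s\<close>.\<close>
  have "d m \<longlonglongrightarrow> 0"
  proof (rule tendsto_0_binomial_coeffs[where m = "2 * m" and b = "max b m"])
    fix n assume n: "max b m \<le> n"
    have "eventually (\<lambda>k. n \<le> card (V k)) sequentially"
      using size by (auto simp: filterlim_at_top)
    then have "eventually (\<lambda>k. e n m k = (\<Sum>s\<le>2 * m. real (n choose s) * d s k)) sequentially"
    proof eventually_elim
      case (elim k)
      have "e n m k = subset_avg (V k) n (\<lambda>U. \<Sum>s\<le>2 * m. \<Sum>S | S \<subseteq> U \<and> card S = s. f k S)"
        unfolding e_def
      proof (rule subset_avg_cong)
        fix U assume "U \<subseteq> V k"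
        then have "finite U" using fin finite_subset by blast
        from sum_pairs_by_union[OF this, where f = "h k" and g = "g k" and m = m]
        show "w k U * (\<Sum>R | R \<subseteq> U \<and> card R = m. g k R) = (\<Sum>s\<le>2 * m. \<Sum>S | S \<subseteq> U \<and> card S = s. f k S)"
          by (simp add: w_def f_def sum_product)
      qed
      then show ?case
        using subset_avg_sum_subsets[OF fin elim] by (simp add: subset_avg_sum d_def)
    qed
    from Lim_transform_eventually[OF e[OF n] this]
    show "(\<lambda>k. \<Sum>s\<le>2 * m. real (n choose s) * d s k) \<longlonglongrightarrow> 0" .
  qed simp
  \<comment> \<open>If two \<open>m\<close>-sets have a union of size \<open>m\<close>, both equal
    that union. So only the diagonal pair contributes to \<open>f k U\<close>.\<close>
  moreover have "d m = (\<lambda>k. subset_avg (V k) m (\<lambda>W. h k W * g k W))"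
    unfolding d_def
  proof (intro ext subset_avg_cong)
    fix k U assume U: "U \<subseteq> V k" "card U = m"
    then have "finite U" using fin finite_subset by blast
    then have "W = U" if "W \<subseteq> U" "card W = m" for W
      using card_subset_eq[OF _ that(1)] that(2) U(2) by simp
    then have "W = U \<and> R = U" if "card W = m" "card R = m" "W \<union> R = U" for W R
      using that by blast
    then have "{(W, R). card W = m \<and> card R = m \<and> W \<union> R = U} \<subseteq> {(U, U)}" by blast
    moreover have "(U, U) \<in> {(W, R). card W = m \<and> card R = m \<and> W \<union> R = U}" using U(2) by simp
    ultimately have "{(W, R). card W = m \<and> card R = m \<and> W \<union> R = U} = {(U, U)}" by blast
    then show "f k U = h k U * g k U" by (simp add: f_def)
  qed
  ultimately show ?thesis by simp
qed

section \<open>Isomorphism classes and limits of finite models\<close>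

text \<open>The part of being a model that isomorphisms need: a bijection of vertex sets can be
  inverted only on tuples inside the vertex set. It also holds for any induced structure and passes
  to reducts.\<close>

definition rels_in :: "('p, 'v) struct \<Rightarrow> bool" where
  "rels_in K \<longleftrightarrow> (\<forall>P. \<forall>xs\<in>Rel K P. set xs \<subseteq> vertices K)"

lemma rels_inD: "rels_in K \<Longrightarrow> xs \<in> Rel K P \<Longrightarrow> set xs \<subseteq> vertices K"
  by (auto simp: rels_in_def)

lemma rels_in_model: "is_model T K \<Longrightarrow> rels_in K"
  unfolding is_model_def rels_in_def by blast

lemma model_RelD:
  assumes "is_model T K" "xs \<in> Rel K P"
  shows "P \<in> preds T \<and> length xs = arity T P \<and> set xs \<subseteq> vertices K"
proof -
  have "P \<in> preds T" using assms unfolding is_model_def by (metis empty_iff)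
  then show ?thesis using assms unfolding is_model_def by blast
qed

lemma iso_refl: "iso K K"
  unfolding iso_def by (intro exI[of _ id]) (simp add: list.map_id0)

lemma iso_trans: "iso K M \<Longrightarrow> iso M N \<Longrightarrow> iso K N"
  unfolding iso_def
proof (elim exE conjE)
  fix f g
  assume "bij_betw f (vertices K) (vertices M)" "\<forall>P. Rel M P = map f ` Rel K P"
    "bij_betw g (vertices M) (vertices N)" "\<forall>P. Rel N P = map g ` Rel M P"
  then show "\<exists>f. bij_betw f (vertices K) (vertices N) \<and> (\<forall>P. Rel N P = map f ` Rel K P)"
    by (intro exI[of _ "g \<circ> f"]) (auto simp: image_image intro: bij_betw_trans)
qed

lemma map_inv_into:
  assumes "inj_on f A" "set xs \<subseteq> A"
  shows "map (inv_into A f) (map f xs) = xs"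
  using assms by (auto intro!: map_idI simp: inv_into_f_f subset_iff)

lemma iso_sym:
  assumes "rels_in K" "iso K N"
  shows "iso N K"
proof -
  from assms(2) obtain f where f: "bij_betw f (vertices K) (vertices N)" "\<And>P. Rel N P = map f ` Rel K P"
    unfolding iso_def by blast
  have "map (inv_into (vertices K) f) ` map f ` Rel K P = Rel K P" for P
  proof -
    have "map (inv_into (vertices K) f) (map f xs) = xs" if "xs \<in> Rel K P" for xs
      using map_inv_into[OF bij_betw_imp_inj_on[OF f(1)] rels_inD[OF assms(1) that]] .
    then show ?thesis unfolding image_image by (auto simp del: map_map simp: image_iff)
  qed
  then show ?thesis unfolding iso_def f(2)
    using bij_betw_inv_into[OF f(1)] by metis
qed

lemma card_iso: "iso K N \<Longrightarrow> card (vertices K) = card (vertices N)"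
  unfolding iso_def by (auto intro: bij_betw_same_card)

text \<open>A valuation in \<open>N\<close> is pulled back along the inverse bijection to one in
  \<open>K\<close> that satisfies the same quantifier-free formulas.\<close>

lemma is_model_iso:
  assumes "is_model T K" "iso K N"
  shows "is_model T N"
proof -
  from assms(2) obtain f where f: "bij_betw f (vertices K) (vertices N)" "\<And>P. Rel N P = map f ` Rel K P"
    unfolding iso_def by blast
  define g where "g = inv_into (vertices K) f"
  have inj: "inj_on f (vertices K)" using f(1) by (rule bij_betw_imp_inj_on)
  have fg: "f (g y) = y" if "y \<in> vertices N" for y
    using that f(1) unfolding g_def by (meson bij_betw_inv_into_right)
  have gK: "g y \<in> vertices K" if "y \<in> vertices N" for y
    using that f(1) unfolding g_def by (metis bij_betw_imp_surj_on inv_into_into)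
  have "sat N s F \<longleftrightarrow> sat K (g \<circ> s) F" if s: "range s \<subseteq> vertices N" for s F
  proof (induction F)
    case (Eq i j)
    have "s i \<in> vertices N" "s j \<in> vertices N" using s by auto
    then show ?case using fg by (metis comp_apply sat.simps(2))
  next
    case (Atom P vs)
    have "f (g (s i)) = s i" for i using s fg by (metis rangeI subsetD)
    then have sv: "map s vs = map f (map (g \<circ> s) vs)" by simp
    have "map (g \<circ> s) vs \<in> Rel K P" if "map s vs = map f xs" "xs \<in> Rel K P" for xs
    proof -
      have "map (g \<circ> s) vs = map g (map f xs)" using that(1) by (metis map_map)
      also have "\<dots> = xs" unfolding g_def
        by (rule map_inv_into[OF inj rels_inD[OF rels_in_model[OF assms(1)] that(2)]])
      finally show ?thesis using that(2) by simp
    qed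
    then show ?case unfolding sat.simps f(2) using sv by blast
  qed auto
  moreover have "range (g \<circ> s) \<subseteq> vertices K" if "range s \<subseteq> vertices N" for s :: "nat \<Rightarrow> _"
    using that gK by auto
  moreover have "set (map f xs) \<subseteq> vertices N" if "set xs \<subseteq> vertices K" for xs
    using that f(1) by (auto simp: bij_betw_def)
  ultimately show ?thesis
    using assms(1) unfolding is_model_def f(2) by (auto simp: image_iff)
qed

text \<open>The axioms are universal: for valuations into \<open>U\<close>, a quantifier-free
  formula has the same truth value in \<open>K\<close> and in the substructure.\<close>

lemma is_model_induced:
  assumes "is_model T K" "U \<subseteq> vertices K"
  shows "is_model T (induced K U)"
proof -
  have "sat (induced K U) s F \<longleftrightarrow> sat K s F" if "range s \<subseteq> U" for s F
    using that by (induction F) (auto simp: induced_def)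
  then show ?thesis using assms unfolding is_model_def
    by (auto simp: induced_def)
qed

lemma iso_class_nonempty:
  assumes "finite (vertices K)"
  obtains N where "N \<in> iso_class K"
proof -
  obtain f where "bij_betw f (vertices K) {..<card (vertices K)}"
    using ex_bij_betw_finite_nat[OF assms] by (auto simp: atLeast0LessThan)
  then have "\<lparr>vertices = {..<card (vertices K)}, Rel = (\<lambda>P. map f ` Rel K P)\<rparr> \<in> iso_class K"
    by (auto simp: iso_class_def iso_def)
  then show thesis by (rule that)
qed

text \<open>Classes contain only structures on natural numbers, so \<open>A\<close> and
  \<open>B\<close> may live on different types. Finiteness of \<open>A\<close> makes its class
  nonempty, and a common member of the two classes links \<open>A\<close> to
  \<open>B\<close>.\<close>

lemma iso_class_eq_iff:
  fixes A :: "('c, 'v) struct" and B :: "('c, 'w) struct"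
  assumes "finite (vertices A)" "rels_in A" "rels_in B"
  shows "iso_class A = iso_class B \<longleftrightarrow> iso A B"
proof
  assume eq: "iso_class A = iso_class B"
  obtain N where "N \<in> iso_class A" using iso_class_nonempty[OF assms(1)] .
  then have "iso A N" "iso B N" using eq by (auto simp: iso_class_def)
  then show "iso A B" using iso_sym[OF assms(3)] iso_trans by blast
next
  assume AB: "iso A B"
  have "iso A N \<longleftrightarrow> iso B N" for N :: "('c, nat) struct"
    using iso_trans[OF AB, of N] iso_trans[OF iso_sym[OF assms(2) AB], of N] by blast
  then show "iso_class A = iso_class B"
    using card_iso[OF AB] by (simp add: iso_class_def)
qed

lemma iso_class_in_models_n:
  assumes "is_model T K" "finite (vertices K)" "card (vertices K) = n"
  shows "iso_class K \<in> models_n T n"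
proof -
  obtain N where "N \<in> iso_class K" using iso_class_nonempty[OF assms(2)] .
  then have N: "iso K N" "vertices N = {..<n}" using assms(3) by (auto simp: iso_class_def)
  have "is_model T N" using is_model_iso[OF assms(1) N(1)] .
  moreover have "iso_class K = iso_class N"
    using N(1) iso_class_eq_iff[OF assms(2) rels_in_model rels_in_model] assms(1) calculation by blast
  ultimately show ?thesis using N(2) by (auto simp: models_n_def)
qed

lemma models_n_rep:
  assumes "C \<in> models_n T n"
  shows "is_model T (rep C)" "vertices (rep C) = {..<n}" "iso_class (rep C) = C" "iso_size C = n"
proof -
  obtain K :: "('a, nat) struct" where K: "is_model T K" "vertices K = {..<n}" "C = iso_class K"
    using assms by (auto simp: models_n_def)
  have "K \<in> C" unfolding K(3) by (simp add: iso_class_def K(2) iso_refl)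
  then have "rep C \<in> C" unfolding rep_def by (rule someI)
  then have r: "iso K (rep C)" and v: "vertices (rep C) = {..<n}"
    using K by (auto simp: iso_class_def)
  show m: "is_model T (rep C)" using is_model_iso[OF K(1) r] .
  show "vertices (rep C) = {..<n}" by (rule v)
  then show "iso_size C = n" by (simp add: iso_size_def)
  show "iso_class (rep C) = C"
    using iso_class_eq_iff[of K "rep C"] r K rels_in_model m by (metis finite_lessThan)
qed

section \<open>Densities and their compactness\<close>

text \<open>Puts densities into the form to which the averaging lemmas apply.\<close>

lemma density_eq_subset_avg:
  assumes "is_model T N" "finite (vertices N)" "C \<in> models_n T n"
  shows "density C N = subset_avg (vertices N) n (\<lambda>U. of_bool (iso_class (induced N U) = C))"
proof -
  note C = models_n_rep[OF assms(3)]
  have *: "subset_avg (vertices N) n (\<lambda>U. of_bool (iso_class (induced N U) = C)) =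
        subset_avg (vertices N) n (\<lambda>U. of_bool (iso (induced N U) (rep C)))"
  proof (rule subset_avg_cong)
    fix U assume "U \<subseteq> vertices N"
    then have "iso_class (induced N U) = iso_class (rep C) \<longleftrightarrow> iso (induced N U) (rep C)"
      using assms C by (intro iso_class_eq_iff)
        (auto simp: induced_def intro: finite_subset rels_in_model is_model_induced[unfolded induced_def])
    then show "of_bool (iso_class (induced N U) = C) = of_bool (iso (induced N U) (rep C))"
      using C(3) by simp
  qed
  have "{U. U \<subseteq> vertices N \<and> card U = n} \<inter> {U. iso (induced N U) (rep C)}
      = {U. U \<subseteq> vertices N \<and> card U = n \<and> iso (induced N U) (rep C)}" by auto
  then show ?thesis
    unfolding * using assms(2) by (simp add: density_def C(4) subset_avg_def of_bool_def sum.If_cases)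
qed

lemma density_bounds:
  assumes "finite (vertices N)"
  shows "density C N \<in> {0..1}"
proof -
  have "card {U. U \<subseteq> vertices N \<and> card U = iso_size C \<and> iso (induced N U) (rep C)}
    \<le> card {U. U \<subseteq> vertices N \<and> card U = iso_size C}"
    using assms by (intro card_mono) auto
  also have "\<dots> = card (vertices N) choose iso_size C" by (rule n_subsets[OF assms])
  finally show ?thesis by (auto simp: density_def divide_le_eq)
qed

lemma finite_models_n:
  assumes "finite (preds T)"
  shows "finite (models_n T n)"
proof -
  let ?L = "\<lambda>P. {xs :: nat list. set xs \<subseteq> {..<n} \<and> length xs = arity T P}"
  let ?F = "{f :: 'a \<Rightarrow> nat list set. \<forall>P. (P \<in> preds T \<longrightarrow> f P \<in> (\<Union>Q\<in>preds T. Pow (?L Q))) \<and> (P \<notin> preds T \<longrightarrow> f P = {})}"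
  have "finite ?F"
    by (intro finite_set_of_finite_funs finite_UN_I assms) (simp add: finite_lists_length_eq)
  moreover have "{K :: ('a, nat) struct. is_model T K \<and> vertices K = {..<n}} \<subseteq>
      (\<lambda>f. \<lparr>vertices = {..<n}, Rel = f\<rparr>) ` ?F"
  proof clarify
    fix K :: "('a, nat) struct" assume K: "is_model T K" "vertices K = {..<n}"
    then have "Rel K \<in> ?F" by (fastforce simp: is_model_def)
    moreover have "K = \<lparr>vertices = {..<n}, Rel = Rel K\<rparr>" using K(2) by simp
    ultimately show "K \<in> (\<lambda>f. \<lparr>vertices = {..<n}, Rel = f\<rparr>) ` ?F" by blast
  qed
  ultimately have "finite {K :: ('a, nat) struct. is_model T K \<and> vertices K = {..<n}}"
    by (meson finite_imageI finite_subset)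
  then show ?thesis unfolding models_n_def by (rule finite_imageI)
qed

text \<open>There are countably many isomorphism classes and all densities lie in the compact
  interval from 0 to 1, so a diagonal subsequence makes every density converge. The limits form a
  limit object by definition.\<close>

lemma Hom_plus_compact:
  fixes N :: "nat \<Rightarrow> ('p, nat) struct"
  assumes "finite (preds T)" "\<And>k. is_model T (N k)" "\<And>k. finite (vertices (N k))"
    and "strict_mono (\<lambda>k. card (vertices (N k)))"
  obtains r \<xi> where "strict_mono (r :: nat \<Rightarrow> nat)" "\<xi> \<in> Hom_plus T"
    "\<And>C. C \<in> models T \<Longrightarrow> (\<lambda>k. density C (N (r k))) \<longlonglongrightarrow> \<xi> C"
proof -
  have count: "countable (models T)"
    unfolding models_def using finite_models_n[OF assms(1)]
    by (intro countable_UN) (auto intro: countable_finite)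
  let ?c = "from_nat_into (models T)"
  interpret subseqs "\<lambda>n s. convergent (\<lambda>k. density (?c n) (N (s k)))"
  proof
    fix n and s :: "nat \<Rightarrow> nat" assume "strict_mono s"
    have "\<forall>k. density (?c n) (N (s k)) \<in> {0..1}" using density_bounds assms(3) by blast
    then obtain x and r :: "nat \<Rightarrow> nat"
      where "strict_mono r" "((\<lambda>k. density (?c n) (N (s k))) \<circ> r) \<longlonglongrightarrow> x"
      using compact_imp_seq_compact[OF compact_Icc, unfolded seq_compact_def] by metis
    then show "\<exists>r. strict_mono r \<and> convergent (\<lambda>k. density (?c n) (N ((s \<circ> r) k)))"
      by (auto simp: convergent_def o_def)
  qed
  have conv: "convergent (\<lambda>k. density C (N (diagseq k)))" if "C \<in> models T" for C
  proof -
    have "\<exists>n. ?c n = C" using from_nat_into_surj[OF count that] .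
    then obtain n where n: "C = ?c n" by metis
    \<comment> \<open>The diagonal sequence refines the sequence built for the class
      \<open>?c n\<close> only from index \<open>Suc n\<close> on; convergence ignores the initial
      terms.\<close>
    have "convergent (\<lambda>k. density (?c n) (N ((diagseq \<circ> (+) (Suc n)) k)))"
    proof (rule diagseq_holds)
      fix r s :: "nat \<Rightarrow> nat" and n
      assume "strict_mono r" "convergent (\<lambda>k. density (?c n) (N (s k)))"
      then show "convergent (\<lambda>k. density (?c n) (N ((s \<circ> r) k)))"
        using convergent_subseq_convergent[of "\<lambda>k. density (?c n) (N (s k))" r] by (simp add: o_def)
    qed
    then have "convergent (\<lambda>k. density (?c n) (N (diagseq (k + Suc n))))" by (simp add: add.commute)
    then show ?thesis unfolding n using convergent_ignore_initial_segment by blast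
  qed
  define \<xi> where "\<xi> = (\<lambda>C\<in>models T. lim (\<lambda>k. density C (N (diagseq k))))"
  have lim: "(\<lambda>k. density C (N (diagseq k))) \<longlonglongrightarrow> \<xi> C" if "C \<in> models T" for C
    using conv[OF that] that by (simp add: \<xi>_def convergent_LIMSEQ_iff)
  have "\<xi> C \<in> {0..1}" if "C \<in> models T" for C
    using closed_sequentially[OF closed_atLeastAtMost _ lim[OF that]] density_bounds assms(3) by blast
  then have "\<xi> \<in> models T \<rightarrow>\<^sub>E {0..1}" by (auto simp: \<xi>_def)
  moreover have "strict_mono (\<lambda>k. card (vertices (N (diagseq k))))"
    using strict_mono_o[OF assms(4) subseq_diagseq] by (simp add: o_def)
  ultimately have "\<xi> \<in> Hom_plus T"
    unfolding Hom_plus_def using lim assms(2,3) by (intro CollectI conjI exI[of _ "\<lambda>k. N (diagseq k)"]) auto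
  then show thesis using that subseq_diagseq lim by blast
qed

section \<open>Reducts and marginals\<close>

text \<open>On models of a disjoint union, the reducts along \<open>Inl\<close> and
  \<open>Inr\<close> are \<open>left_part\<close> and \<open>right_part\<close>. Without their side
  conditions on tuples, reducts commute with induced substructures and preserve isomorphism
  outright.\<close>

definition reduct :: "('p \<Rightarrow> 'q) \<Rightarrow> ('q, 'v) struct \<Rightarrow> ('p, 'v) struct" where
  "reduct f K = \<lparr>vertices = vertices K, Rel = (\<lambda>P. Rel K (f P))\<rparr>"

lemma vertices_reduct [simp]: "vertices (reduct f K) = vertices K"
  and Rel_reduct [simp]: "Rel (reduct f K) P = Rel K (f P)"
  and vertices_induced [simp]: "vertices (induced K U) = U"
  by (simp_all add: reduct_def induced_def)

lemma induced_reduct: "induced (reduct f K) U = reduct f (induced K U)"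
  by (simp add: reduct_def induced_def)

lemma iso_reduct: "iso K N \<Longrightarrow> iso (reduct f K) (reduct f N)"
  by (auto simp: iso_def reduct_def)

lemma left_part_eq_reduct:
  assumes "is_model (disjoint_union T1 T2) K"
  shows "left_part T1 K = reduct Inl K"
proof -
  have "P \<in> preds T1 \<and> length xs = arity T1 P \<and> set xs \<subseteq> vertices K" if "xs \<in> Rel K (Inl P)" for P xs
    using model_RelD[OF assms that] by (auto simp: disjoint_union_def)
  then show ?thesis
    unfolding left_part_def interpret_struct_def erase_left_def reduct_def
    by (auto simp: fun_eq_iff map_nth_vars)
qed

lemma right_part_eq_reduct:
  assumes "is_model (disjoint_union T1 T2) K"
  shows "right_part T2 K = reduct Inr K"
proof -
  have "P \<in> preds T2 \<and> length xs = arity T2 P \<and> set xs \<subseteq> vertices K" if "xs \<in> Rel K (Inr P)" for P xs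
    using model_RelD[OF assms that] by (auto simp: disjoint_union_def)
  then show ?thesis
    unfolding right_part_def interpret_struct_def erase_right_def reduct_def
    by (auto simp: fun_eq_iff map_nth_vars)
qed

text \<open>The density of \<open>C\<close> in a reduct is the sum of the densities of the finitely
  many \<open>D\<close> of the same size whose reduct has type \<open>C\<close>. Limits commute with
  this finite sum, and \<open>pullback\<close> is the same sum for \<open>\<xi>\<close>.\<close>

lemma tendsto_pullback:
  fixes N :: "nat \<Rightarrow> ('q, nat) struct"
  assumes I: "\<And>K :: ('q, nat) struct. is_model T2 K \<Longrightarrow>
      interpret_struct T1 I K = reduct f K \<and> is_model T1 (reduct f K)"
    and "finite (preds T2)" and N: "\<And>k. is_model T2 (N k)" "\<And>k. finite (vertices (N k))"
    and lim: "\<And>D. D \<in> models T2 \<Longrightarrow> (\<lambda>k. density D (N k)) \<longlonglongrightarrow> \<xi> D"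
    and C: "C \<in> models T1"
  shows "(\<lambda>k. density C (reduct f (N k))) \<longlonglongrightarrow> pullback T1 T2 I \<xi> C"
proof -
  obtain n where n: "n \<ge> 1" "C \<in> models_n T1 n" using C by (auto simp: models_def)
  note rC = models_n_rep[OF n(2)]
  let ?S = "{D \<in> models_n T2 n. iso_class (reduct f (rep D)) = C}"
  have S: "{D. D \<in> models_n T2 (iso_size C) \<and> iso (interpret_struct T1 I (rep D)) (rep C)} = ?S"
  proof -
    have "iso (interpret_struct T1 I (rep D)) (rep C) \<longleftrightarrow> iso_class (reduct f (rep D)) = C"
      if "D \<in> models_n T2 n" for D
      using models_n_rep[OF that] rC I[of "rep D"]
        iso_class_eq_iff[of "reduct f (rep D)" "rep C"] rels_in_model
      by (metis finite_lessThan vertices_reduct)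
    then show ?thesis using rC(4) by auto
  qed
  have fS: "finite ?S" using finite_models_n[OF assms(2)] by simp
  have "density C (reduct f (N k)) = (\<Sum>D\<in>?S. density D (N k))" for k
  proof -
    have mk: "is_model T1 (reduct f (N k))" using I N by blast
    have "density C (reduct f (N k)) =
        subset_avg (vertices (N k)) n (\<lambda>U. of_bool (iso_class (induced (reduct f (N k)) U) = C))"
      using density_eq_subset_avg[OF mk _ n(2)] N by simp
    \<comment> \<open>Each \<open>U\<close> contributes through just one \<open>D\<close>, the type
      it induces in \<open>N k\<close>, and this type determines the type induced in the
      reduct.\<close>
    also have "\<dots> = subset_avg (vertices (N k)) n (\<lambda>U. \<Sum>D\<in>?S. of_bool (iso_class (induced (N k) U) = D))"
    proof (rule subset_avg_cong)
      fix U assume U: "U \<subseteq> vertices (N k)" "card U = n"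
      have fU: "finite U" using U N finite_subset by blast
      let ?D = "iso_class (induced (N k) U)"
      have mU: "is_model T2 (induced (N k) U)" using is_model_induced N(1) U(1) by blast
      have D: "?D \<in> models_n T2 n" using iso_class_in_models_n[OF mU] fU U by simp
      note rD = models_n_rep[OF D]
      have "iso (induced (N k) U) (rep ?D)"
        using iso_class_eq_iff[of "induced (N k) U" "rep ?D"] rD mU fU rels_in_model by (metis vertices_induced)
      then have "iso (reduct f (induced (N k) U)) (reduct f (rep ?D))" by (rule iso_reduct)
      then have "iso_class (reduct f (induced (N k) U)) = iso_class (reduct f (rep ?D))"
        using iso_class_eq_iff[of "reduct f (induced (N k) U)" "reduct f (rep ?D)"] I rD(1) mU fU rels_in_model
        by (metis vertices_induced vertices_reduct)
      then have "iso_class (induced (reduct f (N k)) U) = C \<longleftrightarrow> ?D \<in> ?S"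
        using D by (simp add: induced_reduct)
      then show "of_bool (iso_class (induced (reduct f (N k)) U) = C) = (\<Sum>D\<in>?S. of_bool (?D = D))"
        using fS by (simp add: of_bool_def)
    qed
    also have "\<dots> = (\<Sum>D\<in>?S. density D (N k))"
      unfolding subset_avg_sum using density_eq_subset_avg[OF N] by (intro sum.cong) auto
    finally show ?thesis .
  qed
  moreover have "(\<lambda>k. \<Sum>D\<in>?S. density D (N k)) \<longlonglongrightarrow> (\<Sum>D\<in>?S. \<xi> D)"
    using n(1) by (intro tendsto_sum lim) (auto simp: models_def)
  moreover have "pullback T1 T2 I \<xi> C = (\<Sum>D\<in>?S. \<xi> D)"
    unfolding pullback_def restrict_apply'[OF C] S ..
  ultimately show ?thesis by simp
qed

lemma rels_in_induced: "rels_in (induced K W)"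
  by (auto simp: rels_in_def induced_def)

lemma iso_induced:
  assumes f: "bij_betw f (vertices A) (vertices B)" "\<And>P. Rel B P = map f ` Rel A P"
    and "rels_in A" "W \<subseteq> vertices A"
  shows "iso (induced A W) (induced B (f ` W))"
  unfolding iso_def
proof (intro exI[of _ f] conjI allI)
  show "bij_betw f (vertices (induced A W)) (vertices (induced B (f ` W)))"
    using bij_betw_subset[OF f(1) assms(4)] by simp
  fix P
  have "set xs \<subseteq> W" if "xs \<in> Rel A P" "f ` set xs \<subseteq> f ` W" for xs
    using that rels_inD[OF assms(3) that(1)] assms(4) bij_betw_imp_inj_on[OF f(1)]
    by (meson inj_on_image_subset_iff)
  then show "Rel (induced B (f ` W)) P = map f ` Rel (induced A W) P"
    unfolding induced_def f(2) by fastforce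
qed

lemma subset_count_iso:
  assumes "iso A B" "rels_in A" "finite (vertices A)"
  shows "(\<Sum>W | W \<subseteq> vertices A \<and> card W = m. of_bool (iso_class (induced A W) = C)) =
         (\<Sum>W | W \<subseteq> vertices B \<and> card W = m. of_bool (iso_class (induced B W) = C) :: real)"
proof -
  obtain f where f: "bij_betw f (vertices A) (vertices B)" "\<And>P. Rel B P = map f ` Rel A P"
    using assms(1) unfolding iso_def by blast
  have inj: "inj_on f (vertices A)" using f(1) by (rule bij_betw_imp_inj_on)
  have fB: "finite (vertices B)" using assms(3) bij_betw_finite[OF f(1)] by simp
  have same: "iso_class (induced A W) = iso_class (induced B (f ` W))" if "W \<subseteq> vertices A" for W
    using iso_induced[OF f assms(2) that] iso_class_eq_iff[of "induced A W" "induced B (f ` W)"]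
      finite_subset[OF that assms(3)] by (simp add: rels_in_induced)
  \<comment> \<open>The size condition is moved into the summand, so that both sums run over full
    power sets, which \<open>f\<close> maps bijectively.\<close>
  let ?s = "\<lambda>K W. if card W = m then of_bool (iso_class (induced K W) = C) else 0 :: real"
  have "(\<Sum>W\<in>Pow (vertices A). ?s A W) = (\<Sum>W\<in>Pow (vertices A). ?s B (f ` W))"
  proof (rule sum.cong[OF refl])
    fix W assume "W \<in> Pow (vertices A)"
    then have W: "W \<subseteq> vertices A" by simp
    have "card (f ` W) = card W" by (rule card_image[OF inj_on_subset[OF inj W]])
    then show "?s A W = ?s B (f ` W)" by (simp only: same[OF W])
  qed
  also have "\<dots> = (\<Sum>W\<in>Pow (vertices B). ?s B W)"
    by (rule sum.reindex_bij_betw[OF bij_betw_Pow[OF f(1)]])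
  finally show ?thesis
    using assms(3) fB by (simp add: sum.inter_filter[symmetric])
qed

text \<open>Compactness yields limits only along subsequences; this returns to the whole
  sequence.\<close>

lemma tendsto_0_subsubseq:
  fixes z :: "nat \<Rightarrow> real"
  assumes "\<And>s :: nat \<Rightarrow> nat. strict_mono s \<Longrightarrow> \<exists>r :: nat \<Rightarrow> nat. strict_mono r \<and> (\<lambda>k. z (s (r k))) \<longlonglongrightarrow> 0"
  shows "z \<longlonglongrightarrow> 0"
proof (rule ccontr)
  assume "\<not> z \<longlonglongrightarrow> 0"
  then obtain e where e: "e > 0" "\<And>n. \<exists>k\<ge>n. \<bar>z k\<bar> \<ge> e"
    unfolding LIMSEQ_iff by (auto simp: not_less)
  have inf: "infinite {k. \<bar>z k\<bar> \<ge> e}"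
    using e(2) unfolding infinite_nat_iff_unbounded_le by auto
  obtain s :: "nat \<Rightarrow> nat" where s: "strict_mono s" "\<And>k. \<bar>z (s k)\<bar> \<ge> e"
    using infinite_enumerate[OF inf] by auto
  obtain r :: "nat \<Rightarrow> nat" where "(\<lambda>k. z (s (r k))) \<longlonglongrightarrow> 0" using assms[OF s(1)] by blast
  from tendsto_rabs_zero[OF this] have "e \<le> 0"
    by (rule LIMSEQ_le_const) (use s(2) in auto)
  then show False using e(1) by simp
qed

lemma tendsto_pullback_left:
  fixes N :: "nat \<Rightarrow> ('p + 'q, nat) struct"
  assumes "canonical_theory T1" "canonical_theory T2"
    and "\<And>k. is_model (disjoint_union T1 T2) (N k)" "\<And>k. finite (vertices (N k))"
    and "\<And>D. D \<in> models (disjoint_union T1 T2) \<Longrightarrow> (\<lambda>k. density D (N k)) \<longlonglongrightarrow> \<xi> D"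
    and "C \<in> models T1"
  shows "(\<lambda>k. density C (reduct Inl (N k))) \<longlonglongrightarrow> pullback T1 (disjoint_union T1 T2) (erase_left T1) \<xi> C"
proof (rule tendsto_pullback)
  fix K :: "('p + 'q, nat) struct" assume K: "is_model (disjoint_union T1 T2) K"
  then show "interpret_struct T1 (erase_left T1) K = reduct Inl K \<and> is_model T1 (reduct Inl K)"
    using left_part_eq_reduct[OF K] open_interpretation_erase_left[OF assms(1)]
    unfolding left_part_def open_interpretation_def by metis
qed (use assms in \<open>auto simp: canonical_theory_def disjoint_union_def\<close>)

lemma tendsto_pullback_right:
  fixes N :: "nat \<Rightarrow> ('p + 'q, nat) struct"
  assumes "canonical_theory T1" "canonical_theory T2"
    and "\<And>k. is_model (disjoint_union T1 T2) (N k)" "\<And>k. finite (vertices (N k))"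
    and "\<And>D. D \<in> models (disjoint_union T1 T2) \<Longrightarrow> (\<lambda>k. density D (N k)) \<longlonglongrightarrow> \<xi> D"
    and "C \<in> models T2"
  shows "(\<lambda>k. density C (reduct Inr (N k))) \<longlonglongrightarrow> pullback T2 (disjoint_union T1 T2) (erase_right T2) \<xi> C"
proof (rule tendsto_pullback)
  fix K :: "('p + 'q, nat) struct" assume K: "is_model (disjoint_union T1 T2) K"
  then show "interpret_struct T2 (erase_right T2) K = reduct Inr K \<and> is_model T2 (reduct Inr K)"
    using right_part_eq_reduct[OF K] open_interpretation_erase_right[OF assms(2)]
    unfolding right_part_def open_interpretation_def by metis
qed (use assms in \<open>auto simp: canonical_theory_def disjoint_union_def\<close>)

lemma is_model_reduct_left:
  fixes K :: "('p + 'q, nat) struct"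
  assumes "canonical_theory T1" "is_model (disjoint_union T1 T2) K"
  shows "is_model T1 (reduct Inl K)"
  using left_part_eq_reduct[OF assms(2)] open_interpretation_erase_left[OF assms(1)] assms(2)
  unfolding left_part_def open_interpretation_def by metis

lemma is_model_reduct_right:
  fixes K :: "('p + 'q, nat) struct"
  assumes "canonical_theory T2" "is_model (disjoint_union T1 T2) K"
  shows "is_model T2 (reduct Inr K)"
  using right_part_eq_reduct[OF assms(2)] open_interpretation_erase_right[OF assms(1)] assms(2)
  unfolding right_part_def open_interpretation_def by metis

text \<open>The number of copies of \<open>C\<close> inside \<open>U\<close> depends only on the
  type \<open>K\<close> of \<open>U\<close>, namely as \<open>c K\<close>. Averaging over
  \<open>U\<close> gives the corresponding identity of densities, and the difference of the two is
  the centred form. It reduces statements about \<open>m\<close>-subsets of \<open>U\<close> to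
  statements about the type of \<open>U\<close>.\<close>

lemma density_induction:
  assumes L: "is_model T L" "finite (vertices L)" and T: "finite (preds T)"
    and C: "C \<in> models_n T m" and n: "n \<le> card (vertices L)" and U: "U \<subseteq> vertices L" "card U = n"
  defines "c K \<equiv> \<Sum>W | W \<subseteq> vertices (rep K) \<and> card W = m. of_bool (iso_class (induced (rep K) W) = C) :: real"
  shows "(\<Sum>W | W \<subseteq> U \<and> card W = m. of_bool (iso_class (induced L W) = C) - density C L) =
         (\<Sum>K\<in>models_n T n. c K * (of_bool (iso_class (induced L U) = K) - density K L))"
proof -
  have count: "(\<Sum>W | W \<subseteq> U \<and> card W = m. of_bool (iso_class (induced L W) = C)) =
      (\<Sum>K\<in>models_n T n. c K * of_bool (iso_class (induced L U) = K))"
    if U: "U \<subseteq> vertices L" "card U = n" for U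
  proof -
    let ?K = "iso_class (induced L U)"
    have fU: "finite U" using U L finite_subset by blast
    have mU: "is_model T (induced L U)" using is_model_induced[OF L(1) U(1)] .
    have K: "?K \<in> models_n T n" using iso_class_in_models_n[OF mU] fU U by simp
    note rK = models_n_rep[OF K]
    have iso: "iso (induced L U) (rep ?K)"
      using iso_class_eq_iff[of "induced L U" "rep ?K"] fU rels_in_model[OF mU] rels_in_model[OF rK(1)] rK(3) by simp
    have "(\<Sum>W | W \<subseteq> U \<and> card W = m. of_bool (iso_class (induced L W) = C)) =
          (\<Sum>W | W \<subseteq> U \<and> card W = m. of_bool (iso_class (induced (induced L U) W) = C) :: real)"
    proof (intro sum.cong refl)
      fix W assume "W \<in> {W. W \<subseteq> U \<and> card W = m}"
      then have "induced (induced L U) W = induced L W" by (auto simp: induced_def fun_eq_iff)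
      then show "of_bool (iso_class (induced L W) = C) = (of_bool (iso_class (induced (induced L U) W) = C) :: real)"
        by simp
    qed
    also have "\<dots> = c ?K"
      using subset_count_iso[OF iso rels_in_model[OF mU], where m = m and C = C] fU by (simp add: c_def)
    also have "\<dots> = (\<Sum>K\<in>models_n T n. c K * of_bool (?K = K))"
      using K finite_models_n[OF T] by (simp add: of_bool_def if_distrib cong: if_cong)
    finally show ?thesis .
  qed
  have "real (n choose m) * density C L = subset_avg (vertices L) n
      (\<lambda>U. \<Sum>W | W \<subseteq> U \<and> card W = m. of_bool (iso_class (induced L W) = C))"
    using subset_avg_sum_subsets[OF L(2) n] density_eq_subset_avg[OF L C] by simp
  also have "\<dots> = subset_avg (vertices L) n
      (\<lambda>U. \<Sum>K\<in>models_n T n. c K * of_bool (iso_class (induced L U) = K))"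
    using count by (intro subset_avg_cong) auto
  also have "\<dots> = (\<Sum>K\<in>models_n T n. c K * density K L)"
    using density_eq_subset_avg[OF L] by (simp add: subset_avg_sum subset_avg_cmult)
  finally have "real (n choose m) * density C L = (\<Sum>K\<in>models_n T n. c K * density K L)" .
  moreover have "card {W. W \<subseteq> U \<and> card W = m} = n choose m"
    using n_subsets[of U m] U L finite_subset by metis
  ultimately show ?thesis
    using count[OF U] by (simp add: sum_subtractf right_diff_distrib)
qed


section \<open>Cliques in expansions by a hypergraph\<close>

definition tuples :: "nat \<Rightarrow> 'v set \<Rightarrow> 'v list set" where
  "tuples r V = {xs. length xs = r \<and> distinct xs \<and> set xs \<subseteq> V}"

text \<open>Vacuously true for sets with fewer than \<open>r\<close> elements.\<close>

definition clique :: "nat \<Rightarrow> ('p + unit, 'v) struct \<Rightarrow> 'v set \<Rightarrow> bool" where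
  "clique r N S \<longleftrightarrow> tuples r S \<subseteq> Rel N (Inr ())"

lemma map_image_tuples:
  assumes "bij_betw f A B"
  shows "map f ` tuples r A = tuples r B"
proof
  show "map f ` tuples r A \<subseteq> tuples r B"
    using assms by (fastforce simp: tuples_def distinct_map bij_betw_def intro: inj_on_subset)
  show "tuples r B \<subseteq> map f ` tuples r A"
  proof
    fix ys assume ys: "ys \<in> tuples r B"
    let ?g = "inv_into A f"
    have g: "bij_betw ?g B A" by (rule bij_betw_inv_into[OF assms])
    have "ys = map f (map ?g ys)"
      using ys assms by (auto intro!: map_idI[symmetric] simp: tuples_def bij_betw_inv_into_right subset_iff)
    moreover have "map ?g ys \<in> tuples r A"
      using ys g by (auto simp: tuples_def distinct_map bij_betw_def intro: inj_on_subset)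
    ultimately show "ys \<in> map f ` tuples r A" by blast
  qed
qed

text \<open>A bijection carries all tuples to all tuples, so the image of \<open>E\<close> is
  complete exactly when \<open>E\<close> is.\<close>

lemma map_image_eq_tuples_iff:
  assumes f: "bij_betw f A B" and E: "E \<subseteq> tuples r A"
  shows "tuples r B = map f ` E \<longleftrightarrow> tuples r A \<subseteq> E"
proof -
  have "inj_on (map f) (lists A)"
    using inj_on_map_lists[OF bij_betw_imp_inj_on[OF f]] .
  moreover have "tuples r A \<subseteq> lists A" by (auto simp: tuples_def)
  ultimately have "inj_on (map f) (tuples r A)" by (rule inj_on_subset)
  then have "map f ` tuples r A = map f ` E \<longleftrightarrow> tuples r A = E"
    using E by (intro inj_on_image_eq_iff) auto
  then show ?thesis using E unfolding map_image_tuples[OF f] by auto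
qed

abbreviation with_hypergraph :: "'p fo_theory \<Rightarrow> nat \<Rightarrow> ('p + unit) fo_theory" where
  "with_hypergraph T r \<equiv> disjoint_union T (hypergraph_theory r)"

lemma edges_subset_tuples:
  assumes "is_model (with_hypergraph T r) N" "r \<ge> 1"
  shows "Rel N (Inr ()) \<subseteq> tuples r (vertices N)"
proof
  fix xs assume xs: "xs \<in> Rel N (Inr ())"
  from model_RelD[OF assms(1) xs] have len: "length xs = r" and sub: "set xs \<subseteq> vertices N"
    by (auto simp: disjoint_union_def hypergraph_theory_def)
  \<comment> \<open>The axiom concerns valuations of all variables, so \<open>s\<close> is continued
    by the first entry of \<open>xs\<close> to stay among the vertices; \<open>r \<ge> 1\<close>
    ensures that this entry exists.\<close>
  define s where "s i = (if i < r then xs ! i else xs ! 0)" for i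
  have "canonical_axiom r () \<in> axioms (hypergraph_theory r)" by (simp add: hypergraph_theory_def)
  from imageI[OF this, of "map_qf (Inr :: unit \<Rightarrow> 'a + unit)"]
  have "canonical_axiom r (Inr ()) \<in> axioms (with_hypergraph T r)"
    unfolding map_qf_canonical_axiom by (simp add: disjoint_union_def)
  moreover have "range s \<subseteq> vertices N"
  proof -
    have "s i \<in> set xs" for i using assms(2) len by (auto simp: s_def)
    then show ?thesis using sub by blast
  qed
  ultimately have "sat N s (canonical_axiom r (Inr ()))"
    using assms(1) unfolding is_model_def by blast
  moreover have "map s [0..<r] = xs"
    using len by (auto simp: s_def intro: nth_equalityI)
  ultimately have "\<not> (\<exists>i j. i < j \<and> j < r \<and> s i = s j)"
    using xs by (simp add: sat_canonical_axiom)
  then have "xs ! i \<noteq> xs ! j" if "i < j" "j < r" for i j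
    using that unfolding s_def by (metis order.strict_trans)
  then have "distinct xs"
    unfolding distinct_conv_nth len by (metis linorder_neqE_nat)
  then show "xs \<in> tuples r (vertices N)" using len sub by (simp add: tuples_def)
qed

lemma complete_hypergraph_iff_clique:
  assumes "is_model (with_hypergraph T r) N" "r \<ge> 1"
  shows "complete_hypergraph r (right_part (hypergraph_theory r) N) \<longleftrightarrow> clique r N (vertices N)"
  using edges_subset_tuples[OF assms]
  unfolding complete_hypergraph_def right_part_eq_reduct[OF assms(1)] clique_def
  by (auto simp: tuples_def)

section \<open>Structures with a complete hypergraph part\<close>

context
  fixes T :: "'p fo_theory" and r :: nat and D :: "('p + unit, 'w) struct"
  assumes r: "r \<ge> 1" and D: "is_model (with_hypergraph T r) D" "clique r D (vertices D)"
begin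

lemma complete_edges: "Rel D (Inr ()) = tuples r (vertices D)"
  using D edges_subset_tuples[OF D(1) r] by (auto simp: clique_def)

text \<open>Once the hypergraph of \<open>K\<close> is complete too, every bijection respects it, so
  only the first language constrains the isomorphism.\<close>

lemma iso_complete_iff:
  assumes "is_model (with_hypergraph T r) K"
  shows "iso K D \<longleftrightarrow> iso (reduct Inl K) (reduct Inl D) \<and> clique r K (vertices K)"
proof -
  have "bij_betw f (vertices K) (vertices D) \<and> (\<forall>P. Rel D P = map f ` Rel K P) \<longleftrightarrow>
        (bij_betw f (vertices K) (vertices D) \<and> (\<forall>P. Rel D (Inl P) = map f ` Rel K (Inl P)))
          \<and> clique r K (vertices K)" for f
    using map_image_eq_tuples_iff[OF _ edges_subset_tuples[OF assms r], of f "vertices D"] complete_edges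
    by (auto simp: clique_def split_sum_all)
  then show ?thesis by (simp only: iso_def vertices_reduct Rel_reduct ex_simps)
qed

lemma iso_reduct_right_complete_iff:
  assumes "is_model (with_hypergraph T r) K" "finite (vertices K)" "card (vertices K) = card (vertices D)"
    "finite (vertices D)"
  shows "iso (reduct Inr K) (reduct Inr D) \<longleftrightarrow> clique r K (vertices K)"
proof -
  have "(\<forall>P :: unit. Rel D (Inr P) = map f ` Rel K (Inr P)) \<longleftrightarrow> clique r K (vertices K)"
    if "bij_betw f (vertices K) (vertices D)" for f
    using map_image_eq_tuples_iff[OF that edges_subset_tuples[OF assms(1) r]] complete_edges
    by (auto simp: clique_def)
  moreover have "\<exists>f. bij_betw f (vertices K) (vertices D)"
    using finite_same_card_bij[OF assms(2,4,3)] .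
  ultimately show ?thesis unfolding iso_def by auto
qed

text \<open>Every permutation of the vertices preserves the complete hypergraph.\<close>

lemma Aut_complete: "Aut D = Aut (reduct Inl D)"
proof -
  have "Rel D (Inr ()) = map f ` Rel D (Inr ())" if "f permutes vertices D" for f
    unfolding complete_edges map_image_tuples[OF permutes_imp_bij[OF that]] ..
  then show ?thesis unfolding Aut_def by (auto simp: split_sum_all)
qed

lemma Aut_reduct_right_complete: "Aut (reduct Inr D) = {f. f permutes vertices D}"
proof -
  have "Rel D (Inr ()) = map f ` Rel D (Inr ())" if "f permutes vertices D" for f
    unfolding complete_edges map_image_tuples[OF permutes_imp_bij[OF that]] ..
  then show ?thesis unfolding Aut_def by auto
qed

end

text \<open>The automorphism groups of \<open>rep C\<close> and of its left part coincide, and the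
  complete hypergraph has all \<open>n!\<close> permutations as automorphisms. So all normalising
  factors cancel and unlabelled densities simply multiply.\<close>

lemma indep_coupling_complete:
  assumes r: "r \<ge> 1" and n: "n \<ge> 1" and C: "C \<in> models_n (with_hypergraph T r) n"
    and clique: "clique r (rep C) (vertices (rep C))"
  shows "indep_coupling T (hypergraph_theory r) \<phi> \<psi> C =
         \<phi> (iso_class (reduct Inl (rep C))) * \<psi> (iso_class (reduct Inr (rep C)))"
proof -
  note rC = models_n_rep[OF C]
  have "finite (Aut (rep C))"
    using finite_permutations[of "vertices (rep C)"] rC(2) by (auto simp: Aut_def intro: finite_subset[rotated])
  moreover have "id \<in> Aut (rep C)" by (simp add: Aut_def permutes_id list.map_id0)
  ultimately have "card (Aut (rep C)) > 0" by (auto simp: card_gt_0_iff)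
  moreover have "card (Aut (reduct Inr (rep C))) = fact n"
    unfolding Aut_reduct_right_complete[OF r rC(1) clique] rC(2) by (simp add: card_permutations)
  moreover have "C \<in> models (with_hypergraph T r)" using n C by (auto simp: models_def)
  ultimately show ?thesis
    by (simp add: indep_coupling_def labelled_density_def rC left_part_eq_reduct[OF rC(1)]
        right_part_eq_reduct[OF rC(1)] Aut_complete[OF r rC(1) clique, symmetric])
qed

section \<open>Expansions by a prescribed hypergraph\<close>

definition expand :: "('p, 'v) struct \<Rightarrow> 'v list set \<Rightarrow> ('p + unit, 'v) struct" where
  "expand K H = \<lparr>vertices = vertices K, Rel = case_sum (Rel K) (\<lambda>_. H)\<rparr>"

lemma vertices_expand [simp]: "vertices (expand K H) = vertices K"
  and reduct_Inl_expand [simp]: "reduct Inl (expand K H) = K"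
  and edges_expand [simp]: "Rel (expand K H) (Inr ()) = H"
  by (simp_all add: expand_def reduct_def)

text \<open>Permuting the entries of an edge keeps its set of entries, so closure of
  \<open>H\<close> under tuples with the same entries gives the symmetry axioms;
  \<open>H \<subseteq> tuples r (vertices K)\<close> gives the canonical one.\<close>

lemma is_model_expand:
  assumes T: "canonical_theory T" and K: "is_model T K"
    and H: "H \<subseteq> tuples r (vertices K)"
    and sym: "\<And>xs ys. xs \<in> H \<Longrightarrow> ys \<in> tuples r (vertices K) \<Longrightarrow> set ys = set xs \<Longrightarrow> ys \<in> H"
  shows "is_model (with_hypergraph T r) (expand K H)"
  unfolding is_model_def
proof (intro conjI ballI allI impI)
  let ?E = "expand K H :: ('a + unit, 'b) struct"
  fix P xs assume "xs \<in> Rel ?E P"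
  then have "length xs = arity (with_hypergraph T r) P \<and> set xs \<subseteq> vertices K"
    using model_RelD[OF K] H
    by (cases P) (auto simp: expand_def disjoint_union_def hypergraph_theory_def tuples_def)
  then show "length xs = arity (with_hypergraph T r) P" "set xs \<subseteq> vertices ?E" by auto
next
  fix P assume "P \<notin> preds (with_hypergraph T r)"
  then show "Rel (expand K H) P = {}"
    using model_RelD[OF K] by (cases P) (auto simp: expand_def disjoint_union_def hypergraph_theory_def)
next
  let ?E = "expand K H"
  fix F and s :: "nat \<Rightarrow> _" assume F: "F \<in> axioms (with_hypergraph T r)" and s: "range s \<subseteq> vertices ?E"
  have inl: "sat ?E s (map_qf Inl G) \<longleftrightarrow> sat K s G" for G
    by (induction G) (auto simp: expand_def)
  have rel: "Rel ?E (Inr ()) = H" by simp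
  consider (T) G where "G \<in> axioms T" "F = map_qf Inl G"
    | (canonical) "F = canonical_axiom r (Inr ())"
    | (symmetry) \<sigma> where "\<sigma> permutes {..<r}" "F = Imp (Atom (Inr ()) [0..<r]) (Atom (Inr ()) (map \<sigma> [0..<r]))"
    using F by (auto simp: disjoint_union_def hypergraph_theory_def map_qf_canonical_axiom)
  then show "sat ?E s F"
  proof cases
    case T
    then show ?thesis using inl K s by (simp add: is_model_def)
  next
    case canonical
    have "\<not> distinct (map s [0..<r])" if "i < j" "j < r" "s i = s j" for i j
      using that unfolding distinct_conv_nth by force
    then show ?thesis unfolding canonical sat_canonical_axiom rel using H by (auto simp: tuples_def)
  next
    case symmetry
    have "map s (map \<sigma> [0..<r]) \<in> H" if xs: "map s [0..<r] \<in> H"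
    proof -
      let ?ys = "map s (map \<sigma> [0..<r])"
      have set_eq: "set ?ys = set (map s [0..<r])"
        using permutes_image[OF symmetry(1)] by (simp add: atLeast0LessThan flip: image_image)
      have "distinct (map s [0..<r])" using xs H by (auto simp: tuples_def)
      then have "card (set (map s [0..<r])) = r" using distinct_card by fastforce
      \<comment> \<open>A list of length \<open>r\<close> with \<open>r\<close> distinct entries has
        no repetition.\<close>
      then have "distinct ?ys" using set_eq by (intro card_distinct) (metis length_map length_upt minus_nat.diff_0)
      moreover have "set (map s [0..<r]) \<subseteq> vertices K" using xs H unfolding tuples_def by blast
      ultimately have "?ys \<in> tuples r (vertices K)"
        using set_eq by (simp add: tuples_def del: map_map set_map)
      then show ?thesis using sym[OF xs] set_eq by blast
    qed
    then show ?thesis unfolding symmetry(2) sat.simps rel by blast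
  qed
qed


text \<open>Translates types with a complete hypergraph part into clique events; the right part
  alone carries no information beyond the clique event.\<close>

lemma iso_class_induced_complete:
  fixes N :: "('p + unit, nat) struct"
  assumes r: "r \<ge> 1" and N: "is_model (with_hypergraph T r) N" "finite (vertices N)"
    and C: "C \<in> models_n (with_hypergraph T r) n" and clique: "clique r (rep C) (vertices (rep C))"
    and U: "U \<subseteq> vertices N" "card U = n"
  shows "iso_class (induced N U) = C \<longleftrightarrow>
      iso_class (induced (reduct Inl N) U) = iso_class (reduct Inl (rep C)) \<and> clique r N U"
    and "iso_class (induced (reduct Inr N) U) = iso_class (reduct Inr (rep C)) \<longleftrightarrow> clique r N U"
proof -
  note rC = models_n_rep[OF C]
  have fU: "finite U" using U N finite_subset by blast
  let ?K = "induced N U"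
  have K: "is_model (with_hypergraph T r) ?K" by (rule is_model_induced[OF N(1) U(1)])
  have rels: "rels_in ?K" "rels_in (rep C)" by (rule rels_in_model, fact K rC)+
  have rels': "rels_in (reduct Inl ?K)" "rels_in (reduct Inl (rep C))"
    "rels_in (reduct Inr ?K)" "rels_in (reduct Inr (rep C))"
    using rels by (auto simp: rels_in_def)
  have "clique r ?K U \<longleftrightarrow> clique r N U" by (auto simp: clique_def tuples_def induced_def)
  then have cl: "clique r ?K (vertices ?K) \<longleftrightarrow> clique r N U" by simp
  have "iso ?K (rep C) \<longleftrightarrow> iso (reduct Inl ?K) (reduct Inl (rep C)) \<and> clique r N U"
    using iso_complete_iff[OF r rC(1) clique K] cl by simp
  then have "iso_class ?K = iso_class (rep C) \<longleftrightarrow>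
      iso_class (reduct Inl ?K) = iso_class (reduct Inl (rep C)) \<and> clique r N U"
    using iso_class_eq_iff[OF _ rels(1,2)] iso_class_eq_iff[OF _ rels'(1,2)] fU by simp
  then show "iso_class (induced N U) = C \<longleftrightarrow>
      iso_class (induced (reduct Inl N) U) = iso_class (reduct Inl (rep C)) \<and> clique r N U"
    by (simp add: rC(3) induced_reduct)
  have "iso (reduct Inr ?K) (reduct Inr (rep C)) \<longleftrightarrow> clique r N U"
    using iso_reduct_right_complete_iff[OF r rC(1) clique K] cl fU U(2) rC(2) by simp
  then show "iso_class (induced (reduct Inr N) U) = iso_class (reduct Inr (rep C)) \<longleftrightarrow> clique r N U"
    using iso_class_eq_iff[OF _ rels'(3,4)] fU by (simp add: induced_reduct)
qed

text \<open>Supplies, for each type \<open>K\<close> in the language of \<open>T\<close>, the class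
  to which unique inducibility is applied.\<close>

lemma ex_complete_expansion:
  assumes r: "r \<ge> 1" and T: "canonical_theory T" and K: "K \<in> models_n T n"
  obtains C where "C \<in> models_n (with_hypergraph T r) n" "clique r (rep C) (vertices (rep C))"
    "iso_class (reduct Inl (rep C)) = K"
proof -
  note rK = models_n_rep[OF K]
  let ?E = "expand (rep K) (tuples r {..<n})"
  have E: "is_model (with_hypergraph T r) ?E"
    by (rule is_model_expand[OF T rK(1)]) (auto simp: rK(2))
  let ?C = "iso_class ?E"
  have C: "?C \<in> models_n (with_hypergraph T r) n"
    by (rule iso_class_in_models_n[OF E]) (auto simp: rK(2))
  note rC = models_n_rep[OF C]
  have iso: "iso (rep ?C) ?E"
    using iso_class_eq_iff[OF _ rels_in_model[OF rC(1)] rels_in_model[OF E]] rC(2,3) by simp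
  have "clique r ?E (vertices ?E)" by (simp add: clique_def rK(2))
  from iso_complete_iff[OF r E this rC(1)] iso
  have *: "iso (reduct Inl (rep ?C)) (rep K)" "clique r (rep ?C) (vertices (rep ?C))" by simp_all
  have "rels_in (reduct Inl (rep ?C))" using rels_in_model[OF rC(1)] by (auto simp: rels_in_def)
  then have "iso_class (reduct Inl (rep ?C)) = iso_class (rep K)"
    using rC(2) by (intro iffD2[OF iso_class_eq_iff] *(1) rels_in_model[OF rK(1)]) simp_all
  then show thesis using that[OF C *(2)] rK(3) by simp
qed

section \<open>The hypergraph of relative cliques\<close>

definition relative_cliques :: "nat \<Rightarrow> ('p + unit, 'v) struct \<Rightarrow> 'v set \<Rightarrow> 'v list set" where
  "relative_cliques r N R = {xs \<in> tuples (Suc r) (vertices N). clique r N (set xs \<inter> R)}"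

text \<open>An \<open>r\<close>-tuple of \<open>R \<inter> U\<close> is tested by an edge obtained
  by adding one more vertex of \<open>U\<close>, which exists because \<open>card U > r\<close>.
  Conversely, subsets of a clique are cliques.\<close>

lemma clique_relative_cliques:
  assumes "r \<ge> 1" "U \<subseteq> vertices N" "finite U" "card U > r"
  shows "tuples (Suc r) U \<subseteq> relative_cliques r N R \<longleftrightarrow> clique r N (R \<inter> U)"
proof
  assume L: "tuples (Suc r) U \<subseteq> relative_cliques r N R"
  show "clique r N (R \<inter> U)" unfolding clique_def
  proof
    fix ys assume ys: "ys \<in> tuples r (R \<inter> U)"
    then have "card (set ys) < card U" using assms(4) distinct_card[of ys] by (auto simp: tuples_def)
    then have "\<not> U \<subseteq> set ys" using card_mono[of "set ys" U] by auto
    then obtain x where "x \<in> U" "x \<notin> set ys" by blast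
    then have "x # ys \<in> tuples (Suc r) U" using ys by (auto simp: tuples_def)
    then have "clique r N (set (x # ys) \<inter> R)" using L by (auto simp: relative_cliques_def)
    \<comment> \<open>This holds whether or not the added vertex \<open>x\<close> belongs to
      \<open>R\<close>.\<close>
    moreover have "ys \<in> tuples r (set (x # ys) \<inter> R)" using ys by (auto simp: tuples_def)
    ultimately show "ys \<in> Rel N (Inr ())" unfolding clique_def by blast
  qed
next
  assume R: "clique r N (R \<inter> U)"
  show "tuples (Suc r) U \<subseteq> relative_cliques r N R"
  proof
    fix xs assume xs: "xs \<in> tuples (Suc r) U"
    then have "tuples r (set xs \<inter> R) \<subseteq> tuples r (R \<inter> U)" by (auto simp: tuples_def)
    then show "xs \<in> relative_cliques r N R"
      using R xs assms(2) by (auto simp: relative_cliques_def clique_def tuples_def)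
  qed
qed

section \<open>Lowering the uniformity\<close>

lemma density_complete:
  fixes N :: "('p + unit, nat) struct"
  assumes r: "r \<ge> 1" and T: "canonical_theory T" and N: "is_model (with_hypergraph T r) N" "finite (vertices N)"
    and C: "C \<in> models_n (with_hypergraph T r) n" and clique: "clique r (rep C) (vertices (rep C))"
  shows "density C N = subset_avg (vertices N) n
      (\<lambda>U. of_bool (iso_class (induced (reduct Inl N) U) = iso_class (reduct Inl (rep C))) * of_bool (clique r N U))"
    and "iso_class (reduct Inr (rep C)) \<in> models_n (hypergraph_theory r) n"
    and "density (iso_class (reduct Inr (rep C))) (reduct Inr N) =
      subset_avg (vertices N) n (\<lambda>U. of_bool (clique r N U))"
    and "iso_class (reduct Inl (rep C)) \<in> models_n T n"
proof -
  note rC = models_n_rep[OF C]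
  note H = canonical_hypergraph_theory[OF r]
  show "density C N = subset_avg (vertices N) n
      (\<lambda>U. of_bool (iso_class (induced (reduct Inl N) U) = iso_class (reduct Inl (rep C))) * of_bool (clique r N U))"
    unfolding density_eq_subset_avg[OF N C]
    using iso_class_induced_complete(1)[OF r N C clique] by (intro subset_avg_cong) simp
  show C2: "iso_class (reduct Inr (rep C)) \<in> models_n (hypergraph_theory r) n"
    using iso_class_in_models_n[OF is_model_reduct_right[OF H rC(1)]] rC(2) by simp
  show "iso_class (reduct Inl (rep C)) \<in> models_n T n"
    using iso_class_in_models_n[OF is_model_reduct_left[OF T rC(1)]] rC(2) by simp
  have "density (iso_class (reduct Inr (rep C))) (reduct Inr N) = subset_avg (vertices N) n
      (\<lambda>U. of_bool (iso_class (induced (reduct Inr N) U) = iso_class (reduct Inr (rep C))))"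
    using density_eq_subset_avg[OF is_model_reduct_right[OF H N(1)] _ C2] N(2) by simp
  also have "\<dots> = subset_avg (vertices N) n (\<lambda>U. of_bool (clique r N U))"
    using iso_class_induced_complete(2)[OF r N C clique] by (intro subset_avg_cong) simp
  finally show "density (iso_class (reduct Inr (rep C))) (reduct Inr N) =
      subset_avg (vertices N) n (\<lambda>U. of_bool (clique r N U))" .
qed

lemma is_model_relative_cliques:
  assumes "canonical_theory T" "is_model T (reduct Inl N)"
  shows "is_model (with_hypergraph T (Suc r)) (expand (reduct Inl N) (relative_cliques r N R))"
  by (rule is_model_expand[OF assms]) (auto simp: relative_cliques_def)

text \<open>The sets \<open>R k\<close> are arbitrary, so the expansions by relative cliques need
  not converge. Along a subsequence they do, and their limit is a coupling of \<open>\<phi>\<close>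
  with some hypergraph limit \<open>\<psi>\<close>, to which unique inducibility applies.\<close>

lemma UInduce_relative_cliques:
  fixes N :: "nat \<Rightarrow> ('p + unit, nat) struct"
  assumes T: "canonical_theory T" and r: "r \<ge> 1" and UI: "UInduce T \<phi> (Suc r)"
    and N: "\<And>k. is_model T (reduct Inl (N k))" "\<And>k. finite (vertices (N k))"
      "strict_mono (\<lambda>k. card (vertices (N k)))"
    and \<phi>: "\<And>C. C \<in> models T \<Longrightarrow> (\<lambda>k. density C (reduct Inl (N k))) \<longlonglongrightarrow> \<phi> C" "\<phi> \<in> extensional (models T)"
    and K: "K \<in> models_n T n" and n: "n \<ge> Suc r"
  shows "\<exists>s :: nat \<Rightarrow> nat. strict_mono s \<and>
    (\<lambda>k. subset_avg (vertices (N (s k))) n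
      (\<lambda>U. (of_bool (iso_class (induced (reduct Inl (N (s k))) U) = K) - density K (reduct Inl (N (s k))))
        * of_bool (clique r (N (s k)) (R (s k) \<inter> U)))) \<longlonglongrightarrow> 0"
proof -
  let ?H = "hypergraph_theory (Suc r)"
  let ?TH = "with_hypergraph T (Suc r)"
  define M where "M k = expand (reduct Inl (N k)) (relative_cliques r (N k) (R k))" for k
  have H: "canonical_theory ?H" by (rule canonical_hypergraph_theory) simp
  have TH: "canonical_theory ?TH" by (rule canonical_disjoint_union[OF T H])
  have M: "is_model ?TH (M k)" "vertices (M k) = vertices (N k)" "reduct Inl (M k) = reduct Inl (N k)" for k
    unfolding M_def using is_model_relative_cliques[OF T N(1)] by simp_all
  obtain s \<xi> where s: "strict_mono (s :: nat \<Rightarrow> nat)" and \<xi>: "\<xi> \<in> Hom_plus ?TH"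
    and lim: "\<And>C. C \<in> models ?TH \<Longrightarrow> (\<lambda>k. density C (M (s k))) \<longlonglongrightarrow> \<xi> C"
    using Hom_plus_compact[of ?TH M] TH M N(2,3) by (auto simp: canonical_theory_def)
  have Ms: "is_model ?TH (M (s k))" "finite (vertices (M (s k)))" for k using M N(2) by auto
  \<comment> \<open>No hypergraph limit is given in advance: \<open>\<psi>\<close> is the right
    marginal of \<open>\<xi>\<close>, and the right reducts of \<open>M (s k)\<close> witness that
    it is a limit object.\<close>
  define \<psi> where "\<psi> = pullback ?H ?TH (erase_right ?H) \<xi>"
  have lim_right: "(\<lambda>k. density C (reduct Inr (M (s k)))) \<longlonglongrightarrow> \<psi> C" if "C \<in> models ?H" for C
    unfolding \<psi>_def using tendsto_pullback_right[OF T H Ms lim that] .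
  have "\<psi> C \<in> {0..1}" if "C \<in> models ?H" for C
    using closed_sequentially[OF closed_atLeastAtMost _ lim_right[OF that]] density_bounds Ms(2)
    by (metis vertices_reduct)
  moreover have "\<psi> \<in> extensional (models ?H)" by (simp add: \<psi>_def pullback_def)
  ultimately have "\<psi> \<in> models ?H \<rightarrow>\<^sub>E {0..1}" by (auto simp: PiE_def)
  moreover have "strict_mono (\<lambda>k. card (vertices (N (s k))))"
    using strict_mono_o[OF N(3) s] by (simp add: o_def)
  ultimately have \<psi>: "\<psi> \<in> Hom_plus ?H"
    unfolding Hom_plus_def using lim_right Ms M(2) is_model_reduct_right[OF H Ms(1)]
    by (intro CollectI conjI exI[of _ "\<lambda>k. reduct Inr (M (s k))"]) auto
  have lim_left: "(\<lambda>k. density C (reduct Inl (N (s k)))) \<longlonglongrightarrow> \<phi> C" if "C \<in> models T" for C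
    using LIMSEQ_subseq_LIMSEQ[OF \<phi>(1)[OF that] s] by (simp add: o_def)
  \<comment> \<open>Expanding leaves the \<open>T\<close>-part of \<open>N k\<close> unchanged, so
    the left marginal is still \<open>\<phi>\<close>; extensionality turns agreement on
    \<open>models T\<close> into equality.\<close>
  have "pullback T ?TH (erase_left T) \<xi> = \<phi>"
  proof (rule extensionalityI)
    show "pullback T ?TH (erase_left T) \<xi> \<in> extensional (models T)" by (simp add: pullback_def)
    show "\<phi> \<in> extensional (models T)" by (rule \<phi>(2))
    fix C assume C: "C \<in> models T"
    show "pullback T ?TH (erase_left T) \<xi> C = \<phi> C"
      using LIMSEQ_unique[OF tendsto_pullback_left[OF T H Ms lim C]] lim_left[OF C] M(3) by simp
  qed
  then have coup: "\<xi> \<in> couplings T ?H \<phi> \<psi>"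
    using \<xi> by (simp add: couplings_def \<psi>_def)
  obtain C where C: "C \<in> models_n ?TH n" "clique (Suc r) (rep C) (vertices (rep C))"
    and CK: "iso_class (reduct Inl (rep C)) = K"
    using ex_complete_expansion[OF _ T K, of "Suc r"] by auto
  let ?C2 = "iso_class (reduct Inr (rep C))"
  have Cm: "C \<in> models ?TH" using C n by (auto simp: models_def)
  have Km: "K \<in> models T" using K n by (auto simp: models_def)
  note dens = density_complete[OF _ T Ms C, simplified]
  have C2m: "?C2 \<in> models ?H" using dens(2) n by (auto simp: models_def)
  have "complete_hypergraph (Suc r) (right_part ?H (rep C))"
    using complete_hypergraph_iff_clique[OF models_n_rep(1)[OF C(1)]] C(2) by simp
  then have "\<xi> C = indep_coupling T ?H \<phi> \<psi> C"
    using UI \<psi> coup Cm unfolding UInduce_def by auto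
  also have "\<dots> = \<phi> K * \<psi> ?C2"
    using indep_coupling_complete[OF _ _ C] n CK by simp
  finally have "\<xi> C = \<phi> K * \<psi> ?C2" .
  moreover have "(\<lambda>k. density C (M (s k)) - density K (reduct Inl (N (s k))) * density ?C2 (reduct Inr (M (s k))))
      \<longlonglongrightarrow> \<xi> C - \<phi> K * \<psi> ?C2"
    by (intro tendsto_diff tendsto_mult lim lim_left lim_right Cm Km C2m)
  moreover have "density C (M (s k)) - density K (reduct Inl (N (s k))) * density ?C2 (reduct Inr (M (s k))) =
      subset_avg (vertices (N (s k))) n
      (\<lambda>U. (of_bool (iso_class (induced (reduct Inl (N (s k))) U) = K) - density K (reduct Inl (N (s k))))
        * of_bool (clique r (N (s k)) (R (s k) \<inter> U)))" for k
  proof -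
    \<comment> \<open>Here \<open>n \<ge> Suc r\<close> enters: completeness of the new hypergraph
      on smaller sets would be vacuous.\<close>
    have "clique (Suc r) (M (s k)) U \<longleftrightarrow> clique r (N (s k)) (R (s k) \<inter> U)"
      if "U \<subseteq> vertices (N (s k))" "card U = n" for U
      using clique_relative_cliques[OF r that(1) finite_subset[OF that(1) N(2)]] that(2) n
      unfolding clique_def[of "Suc r"] by (simp add: M_def)
    then show ?thesis
      unfolding dens M(2,3) CK subset_avg_cmult[symmetric] subset_avg_diff[symmetric]
      by (intro subset_avg_cong) (simp add: left_diff_distrib)
  qed
  ultimately have "(\<lambda>k. subset_avg (vertices (N (s k))) n
      (\<lambda>U. (of_bool (iso_class (induced (reduct Inl (N (s k))) U) = K) - density K (reduct Inl (N (s k))))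
        * of_bool (clique r (N (s k)) (R (s k) \<inter> U)))) \<longlonglongrightarrow> 0" by simp
  then show ?thesis using s by blast
qed

text \<open>For a class with complete hypergraph part, the deviation of \<open>\<xi>\<close> from
  the independent coupling is the limiting covariance of a type with the clique event;
  \<open>clique_decoupling\<close> shows that it vanishes.\<close>

lemma UInduce_Suc_imp:
  fixes T :: "'p fo_theory"
  assumes T: "canonical_theory T" and r: "r \<ge> 1" and UI: "UInduce T \<phi> (Suc r)"
  shows "UInduce T \<phi> r"
  unfolding UInduce_def
proof (intro impI ballI)
  let ?H = "hypergraph_theory r"
  let ?TH = "with_hypergraph T r"
  fix \<psi> \<xi> C
  assume \<psi>: "\<psi> \<in> Hom_plus ?H" and \<xi>: "\<xi> \<in> couplings T ?H \<phi> \<psi>"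
    and Cm: "C \<in> models ?TH" and complete: "complete_hypergraph r (right_part ?H (rep C))"
  have H: "canonical_theory ?H" by (rule canonical_hypergraph_theory[OF r])
  obtain m where m: "m \<ge> 1" and C: "C \<in> models_n ?TH m" using Cm by (auto simp: models_def)
  have clique: "clique r (rep C) (vertices (rep C))"
    using complete_hypergraph_iff_clique[OF models_n_rep(1)[OF C] r] complete by simp
  obtain N :: "nat \<Rightarrow> ('p + unit, nat) struct"
    where N: "\<And>k. is_model ?TH (N k)" "\<And>k. finite (vertices (N k))"
      "strict_mono (\<lambda>k. card (vertices (N k)))"
      and lim: "\<And>D. D \<in> models ?TH \<Longrightarrow> (\<lambda>k. density D (N k)) \<longlonglongrightarrow> \<xi> D"
    using \<xi> unfolding couplings_def Hom_plus_def by blast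
  have left: "pullback T ?TH (erase_left T) \<xi> = \<phi>" and right: "pullback ?H ?TH (erase_right ?H) \<xi> = \<psi>"
    using \<xi> by (auto simp: couplings_def)
  have lim_left: "(\<lambda>k. density D (reduct Inl (N k))) \<longlonglongrightarrow> \<phi> D" if "D \<in> models T" for D
    using tendsto_pullback_left[OF T H N(1,2) lim that] left by simp
  have lim_right: "(\<lambda>k. density D (reduct Inr (N k))) \<longlonglongrightarrow> \<psi> D" if "D \<in> models ?H" for D
    using tendsto_pullback_right[OF T H N(1,2) lim that] right by simp
  have ext: "\<phi> \<in> extensional (models T)" unfolding left[symmetric] by (simp add: pullback_def)
  have L: "is_model T (reduct Inl (N k))" for k by (rule is_model_reduct_left[OF T N(1)])
  note dens = density_complete[OF r T N(1,2) C clique]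
  define C1 where "C1 = iso_class (reduct Inl (rep C))"
  define C2 where "C2 = iso_class (reduct Inr (rep C))"
  have C1: "C1 \<in> models_n T m" "C1 \<in> models T" and C2: "C2 \<in> models ?H"
    using dens(2,4) m by (auto simp: C1_def C2_def models_def)
  define h where "h k W = of_bool (iso_class (induced (reduct Inl (N k)) W) = C1)
      - density C1 (reduct Inl (N k))" for k W
  define g where "g k S = (of_bool (clique r (N k) S) :: real)" for k S
  have decoupled: "(\<lambda>k. subset_avg (vertices (N k)) m (\<lambda>W. h k W * g k W)) \<longlonglongrightarrow> 0"
  proof (rule clique_decoupling[where b = "Suc r"])
    show "filterlim (\<lambda>k. card (vertices (N k))) at_top sequentially"
      by (rule filterlim_subseq[OF N(3)])
    fix n and R :: "nat \<Rightarrow> nat set" assume n: "n \<ge> Suc r"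
    \<comment> \<open>The copy counts of \<open>density_induction\<close>: the sum of
      \<open>h k\<close> over \<open>m\<close>-subsets of \<open>U\<close> becomes a combination,
      with coefficients \<open>c K\<close>, of centred indicators of the type of
      \<open>U\<close>.\<close>
    define c where "c K = (\<Sum>W | W \<subseteq> vertices (rep K) \<and> card W = m.
        of_bool (iso_class (induced (rep K) W) = C1) :: real)" for K
    define Z where "Z K k = subset_avg (vertices (N k)) n
        (\<lambda>U. (of_bool (iso_class (induced (reduct Inl (N k)) U) = K) - density K (reduct Inl (N k))) * g k (R k \<inter> U))"
      for K k
    \<comment> \<open>Every subsequence of \<open>N\<close> still has \<open>T\<close>-parts
      converging to \<open>\<phi>\<close>, so each one has a further subsequence along which
      \<open>Z K\<close> tends to 0.\<close>
    have "Z K \<longlonglongrightarrow> 0" if K: "K \<in> models_n T n" for K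
    proof (rule tendsto_0_subsubseq)
      fix s :: "nat \<Rightarrow> nat" assume s: "strict_mono s"
      have "(\<lambda>k. density D (reduct Inl (N (s k)))) \<longlonglongrightarrow> \<phi> D" if "D \<in> models T" for D
        using LIMSEQ_subseq_LIMSEQ[OF lim_left[OF that] s] by (simp add: o_def)
      moreover have "strict_mono (\<lambda>k. card (vertices (N (s k))))"
        using strict_mono_o[OF N(3) s] by (simp add: o_def)
      ultimately show "\<exists>q :: nat \<Rightarrow> nat. strict_mono q \<and> (\<lambda>k. Z K (s (q k))) \<longlonglongrightarrow> 0"
        using UInduce_relative_cliques[OF T r UI, of "\<lambda>k. N (s k)" K n "\<lambda>k. R (s k)"] L N(2) ext K n
        unfolding Z_def g_def by blast
    qed
    then have "(\<lambda>k. \<Sum>K\<in>models_n T n. c K * Z K k) \<longlonglongrightarrow> (\<Sum>K\<in>models_n T n. c K * 0)"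
      by (intro tendsto_sum tendsto_mult tendsto_const)
    then have limit: "(\<lambda>k. \<Sum>K\<in>models_n T n. c K * Z K k) \<longlonglongrightarrow> 0" by simp
    have "eventually (\<lambda>k. n \<le> card (vertices (N k))) sequentially"
      using filterlim_subseq[OF N(3)] by (auto simp: filterlim_at_top)
    then have "eventually (\<lambda>k. (\<Sum>K\<in>models_n T n. c K * Z K k) =
        subset_avg (vertices (N k)) n (\<lambda>U. (\<Sum>W | W \<subseteq> U \<and> card W = m. h k W) * g k (R k \<inter> U))) sequentially"
    proof eventually_elim
      case (elim k)
      have "(\<Sum>W | W \<subseteq> U \<and> card W = m. h k W) = (\<Sum>K\<in>models_n T n.
          c K * (of_bool (iso_class (induced (reduct Inl (N k)) U) = K) - density K (reduct Inl (N k))))"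
        if "U \<subseteq> vertices (N k)" "card U = n" for U
        unfolding h_def c_def using T N(2) elim that
        by (intro density_induction[OF L]) (auto simp: canonical_theory_def C1)
      then have "subset_avg (vertices (N k)) n (\<lambda>U. (\<Sum>W | W \<subseteq> U \<and> card W = m. h k W) * g k (R k \<inter> U)) =
          subset_avg (vertices (N k)) n (\<lambda>U. \<Sum>K\<in>models_n T n. c K *
            ((of_bool (iso_class (induced (reduct Inl (N k)) U) = K) - density K (reduct Inl (N k))) * g k (R k \<inter> U)))"
        by (intro subset_avg_cong) (simp add: sum_distrib_right mult.assoc)
      then show ?case by (simp add: subset_avg_sum subset_avg_cmult Z_def)
    qed
    then show "(\<lambda>k. subset_avg (vertices (N k)) n
        (\<lambda>U. (\<Sum>W | W \<subseteq> U \<and> card W = m. h k W) * g k (R k \<inter> U))) \<longlonglongrightarrow> 0"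
      by (rule Lim_transform_eventually[OF limit])
  qed (rule N(2))
  \<comment> \<open>The average of the centred product is a covariance, and its three densities
    converge to the values of \<open>\<xi>\<close>, \<open>\<phi>\<close> and
    \<open>\<psi>\<close>.\<close>
  have difference: "subset_avg (vertices (N k)) m (\<lambda>W. h k W * g k W) =
      density C (N k) - density C1 (reduct Inl (N k)) * density C2 (reduct Inr (N k))" for k
    unfolding dens(1,3)[folded C1_def C2_def] subset_avg_cmult[symmetric] subset_avg_diff[symmetric]
    by (simp add: h_def g_def left_diff_distrib)
  have "(\<lambda>k. density C (N k) - density C1 (reduct Inl (N k)) * density C2 (reduct Inr (N k)))
      \<longlonglongrightarrow> \<xi> C - \<phi> C1 * \<psi> C2"
    by (intro tendsto_diff tendsto_mult lim lim_left lim_right Cm C1 C2)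
  from LIMSEQ_unique[OF this decoupled[unfolded difference]]
  have "\<xi> C - \<phi> C1 * \<psi> C2 = 0" .
  then show "\<xi> C = indep_coupling T ?H \<phi> \<psi> C"
    using indep_coupling_complete[OF r m C clique] by (simp add: C1_def C2_def)
qed

section \<open>Independence and the three implications\<close>

text \<open>Lowering \<open>l\<close> enlarges the set of coordinates on which the peon may depend;
  the new base is the cylinder over the old one.\<close>

lemma peon_independent_antimono:
  assumes "peon_independent \<Omega> k S l" "l' \<le> l"
  shows "peon_independent \<Omega> k S l'"
proof -
  let ?A = "fin_subsets_gt {..<k} l" and ?B = "fin_subsets_gt {..<k} l'"
  obtain H where S: "S = {x \<in> space (E_space \<Omega> {..<k}). restrict x ?A \<in> H}"
    using assms(1) unfolding peon_independent_def by blast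
  let ?H = "{y \<in> ?B \<rightarrow>\<^sub>E space \<Omega>. restrict y ?A \<in> H}"
  have "?B \<inter> ?A = ?A" using assms(2) by (auto simp: fin_subsets_gt_def)
  then have restr: "restrict (restrict x ?B) ?A = restrict x ?A" for x :: "nat set \<Rightarrow> 'a"
    by (simp add: restrict_restrict)
  have mem: "restrict x ?B \<in> ?B \<rightarrow>\<^sub>E space \<Omega>" if "x \<in> space (E_space \<Omega> {..<k})" for x
    using that by (auto simp: E_space_def space_PiM PiE_def fin_subsets_gt_def)
  have "S = {x \<in> space (E_space \<Omega> {..<k}). restrict x ?B \<in> ?H}"
    unfolding S by (intro Collect_cong conj_cong refl) (simp only: mem_Collect_eq restr mem simp_thms)
  then show ?thesis unfolding peon_independent_def by (intro exI[of _ ?H]) blast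
qed

theorem theorem3p1:
  fixes T :: "'p fo_theory"
    and \<phi> :: "'p iso_type \<Rightarrow> real"
    and l :: nat
  assumes "canonical_theory T"
    and "\<phi> \<in> Hom_plus T"
    and "l \<ge> 1"
  shows "(Independence TYPE('x) T \<phi> l \<longrightarrow> Independence TYPE('x) T \<phi> (l - 1)) \<and>
         (UCouple TYPE('x) T \<phi> l \<longrightarrow> UCouple TYPE('x) T \<phi> (l - 1)) \<and>
         (UInduce T \<phi> l \<longrightarrow> UInduce T \<phi> (l - 1))"
proof (intro conjI impI)
  assume "Independence TYPE('x) T \<phi> l"
  then show "Independence TYPE('x) T \<phi> (l - 1)"
    unfolding Independence_def using peon_independent_antimono[OF _ diff_le_self] by blast
next
  assume UC: "UCouple TYPE('x) T \<phi> l"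
  \<comment> \<open>Limit objects of rank at most \<open>l - 1\<close> are among those of rank at
    most \<open>l\<close>, so unique coupling is required of fewer \<open>\<psi>\<close>.\<close>
  have "enat (l - 1) \<le> enat l" by simp
  then show "UCouple TYPE('x) T \<phi> (l - 1)"
    using UC unfolding UCouple_def by (meson order_trans)
next
  assume UI: "UInduce T \<phi> l"
  show "UInduce T \<phi> (l - 1)"
  \<comment> \<open>For \<open>l = 1\<close> the target is \<open>UInduce\<close> at 0, which holds
    by definition; otherwise \<open>l - 1\<close> is a genuine uniformity.\<close>
  proof (cases "l = 1")
    case True
    then show ?thesis by (simp add: UInduce_def)
  next
    case False
    then have "l - 1 \<ge> 1" "Suc (l - 1) = l" using assms(3) by auto
    then show ?thesis using UInduce_Suc_imp[OF assms(1), of "l - 1" \<phi>] UI by simp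
  qed
qed

end
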